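(* Let $p\ge 1$ be an integer, let $a_1,\ldots,a_{p+1},b_1,\ldots,b_p$ be complex numbers with no $a_j$ equal to a nonpositive integer, and put $s_p=b_1+\cdots+b_p-a_1-a_2-\cdots-a_{p+1}$. Suppose $\Re(a_j)>0$ for $j=3,\ldots,p+1$. If $s_p$ is equal to zero, then the infinite series over $k$ below converges and $$\sum_{l=0}^{m-1}\frac{\Gamma(a_1+l)\Gamma(a_2+l)\cdots\Gamma(a_{p+1}+l)}{\Gamma(b_1+l)\cdots\Gamma(b_p+l)\Gamma(1+l)}=\sum_{k=1}^\infty\frac{\Gamma(k)}{(a_1)_k(a_2)_k}A_k^{(p)}+\psi(1)-\psi(a_1)-\psi(a_2)+\psi(m)+\bigl[a_1a_2-A_1^{(p)}\bigr](m-1)^{-1}$$ $$-\tfrac14\bigl[a_1(a_1+1)a_2(a_2+1)-2(a_1+1)(a_2+1)A_1^{(p)}+2A_2^{(p)}\bigr]\,[(m-1)(m-2)]^{-1}+O(m^{-3})$$ as $m\to\infty$ through the positive integers.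
   Context: $\psi=\Gamma'/\Gamma$ is the digamma function. $(x)_n=x(x+1)\cdots(x+n-1)=\Gamma(x+n)/\Gamma(x)$ is the Pochhammer symbol, $(x)_0=1$. The coefficients $A_k^{(p)}=A_k^{(p)}(a_3,\ldots,a_{p+1};b_1,\ldots,b_p)$, $k=0,1,2,\ldots$, are defined recursively in $p$: $A_0^{(1)}=1$ and $A_k^{(1)}=0$ for $k>0$; for $p\ge2$, $$A_k^{(p)}(a_3,\ldots,a_{p+1};b_1,\ldots,b_p)=\sum_{j=0}^{k}\frac{\bigl(\sum_{i=2}^{p}b_i-\sum_{i=3}^{p+1}a_i+j\bigr)_{k-j}\,(b_1-a_3)_{k-j}}{(k-j)!}\,A_j^{(p-1)}(a_4,\ldots,a_{p+1};b_2,\ldots,b_p).$$ For example $A_k^{(2)}=(b_2-a_3)_k(b_1-a_3)_k/k!$ and $A_k^{(3)}=\sum_{j=0}^k\frac{(b_3+b_2-a_4-a_3+j)_{k-j}(b_1-a_3)_{k-j}(b_3-a_4)_j(b_2-a_4)_j}{(k-j)!\,j!}$. The parameters are fixed and $m\to\infty$. $1/\Gamma$ is regarded as an entire function (zero at nonpositive integers). *)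

theory Defs
  imports "HOL-Analysis.Analysis" "HOL-Library.Landau_Symbols"
begin

text \<open>
  Only the values \<open>a 3, \<dots>, a (p + 1)\<close> and \<open>b 1, \<dots>, b p\<close> enter \<open>A_coeff p a b\<close>; the recursive
  call for \<open>p - 1\<close> takes the parameters \<open>a 4, \<dots>, a (p + 1)\<close> and \<open>b 2, \<dots>, b p\<close>, which is why both
  sequences are shifted by one. The value at \<open>p = 0\<close> is a dummy.
\<close>

fun A_coeff :: "nat \<Rightarrow> (nat \<Rightarrow> complex) \<Rightarrow> (nat \<Rightarrow> complex) \<Rightarrow> nat \<Rightarrow> complex" where
  "A_coeff 0 a b k = 0"
| "A_coeff (Suc 0) a b k = (if k = 0 then 1 else 0)"
| "A_coeff (Suc (Suc q)) a b k =
     (let p = Suc (Suc q) in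
        \<Sum>j=0..k. pochhammer ((\<Sum>i=2..p. b i) - (\<Sum>i=3..p+1. a i) + of_nat j) (k - j)
                  * pochhammer (b 1 - a 3) (k - j) / fact (k - j)
                  * A_coeff (Suc q) (\<lambda>i. a (Suc i)) (\<lambda>i. b (Suc i)) j)"

text \<open>
  The factors \<open>1 / \<Gamma>(b\<^sub>j + l)\<close> are rendered by the entire function \<^const>\<open>rGamma\<close>.
\<close>

definition hyp_term :: "nat \<Rightarrow> (nat \<Rightarrow> complex) \<Rightarrow> (nat \<Rightarrow> complex) \<Rightarrow> nat \<Rightarrow> complex" where
  "hyp_term p a b l =
     (\<Prod>j=1..p+1. Gamma (a j + of_nat l)) * (\<Prod>j=1..p. rGamma (b j + of_nat l))
       * rGamma (1 + of_nat l)"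

end

theory Submission
  imports Defs
begin

text \<open>
  Write \<open>x = a\<^sub>1\<close>, \<open>y = a\<^sub>2\<close>. The part of the hypergeometric term that does not involve \<open>x\<close> and \<open>y\<close>
  is a quotient of \<open>p - 1\<close> Gamma values by \<open>p\<close> Gamma values, and it equals the inverse factorial series
  \<open>(\<Prod>\<^sub>j\<^sub>\<ge>\<^sub>3 \<Gamma>(a\<^sub>j + l)) / (\<Prod>\<^sub>j \<Gamma>(b\<^sub>j + l)) = \<Sum>\<^sub>k A\<^sub>k / \<Gamma>(x + y + l + k)\<close>,
  because \<open>\<Sum>b\<^sub>j - \<Sum>\<^sub>j\<^sub>\<ge>\<^sub>3 a\<^sub>j = x + y\<close> (lemma \<open>A_coeff_factorial_series\<close>). For \<open>p = 1\<close> this is trivial. The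
  recursion in \<open>p\<close> is Gauss's summation theorem (\<open>gauss_summation\<close>): multiplying the series by
  \<open>\<Gamma>(a\<^sub>3 + l) / \<Gamma>(b\<^sub>1 + l)\<close> expands each of its terms into another inverse factorial series, and collecting
  equal indices produces the convolution that defines the coefficients.

  The delicate point is that this rearrangement of a double series is absolutely convergent
  only if \<open>Re b\<^sub>1 > Re a\<^sub>3\<close>, which is not assumed. Multiplication of a factorial series by a linear factor in \<open>l\<close> is a
  first-order difference operator on its coefficients, and it commutes, up to a shift of the
  parameter, with multiplication by the Gamma quotient. Hence the class of coefficient sequences all of whose
  images under such difference operators stay absolutely summable (\<open>fac_smooth\<close>) is preserved in the
  convergent case, and the general case follows by raising \<open>b\<^sub>1\<close> by an integer and lowering it again
  with the difference operator (\<open>gauss_op_smooth\<close>).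

  It remains to sum \<open>u\<^sub>k(l) = \<Gamma>(x+l)\<Gamma>(y+l) / (\<Gamma>(x+y+k+l) l!)\<close> over \<open>l < m\<close>. For \<open>k \<ge> 3\<close> the terms are \<open>O(l\<^sup>-\<^sup>4)\<close>
  uniformly enough that the double series over \<open>k\<close> and \<open>l\<close> may be interchanged; the sums over \<open>l\<close> are
  Gauss series, which give the terms of the series over \<open>k\<close>, and the remainder is \<open>O(m\<^sup>-\<^sup>3)\<close>. The cases \<open>k = 1, 2\<close> telescope to
  the ratio \<open>v(m) = \<Gamma>(x+m)\<Gamma>(y+m) / (\<Gamma>(x+y+m)\<Gamma>(m))\<close>. Its expansion in negative powers of \<open>m\<close> follows by
  comparing its differences with those of the proposed expansion (\<open>base_ratio_expansion\<close>), and the same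
  comparison settles \<open>k = 0\<close> once the constant \<open>\<psi>(1) - \<psi>(x) - \<psi>(y)\<close> is known. That constant comes from one
  more factorial series, in which only \<open>x\<close> enters the Gamma quotients to be summed, together with
  Newton's series \<open>\<psi>(1) - \<psi>(s) = \<Sum>\<^sub>k\<^sub>\<ge>\<^sub>1 (1-s)\<^sub>k / (k k!)\<close> (\<open>digamma_limit_general\<close>).
\<close>

section \<open>Rearranging absolutely convergent double series\<close>

text \<open>
  The passage from iterated series to unordered sums over pairs, which can be regrouped freely.
\<close>

lemma abs_summable_iterated_series:
  fixes f :: "nat \<Rightarrow> nat \<Rightarrow> complex"
  assumes "\<And>j. summable (\<lambda>n. norm (f j n))"
    and "summable (\<lambda>j. \<Sum>n. norm (f j n))"
  shows "(\<lambda>x. norm (case_prod f x)) summable_on (UNIV \<times> UNIV)"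
proof -
  have eq: "(\<Sum>\<^sub>\<infinity>n. norm (f j n)) = (\<Sum>n. norm (f j n))" for j
    using assms(1)[of j] by (intro infsumI norm_summable_imp_has_sum) (auto intro: summable_sums)
  have "(\<lambda>n. norm (f j n)) summable_on UNIV" for j
    using assms(1)[of j] by (subst summable_on_UNIV_nonneg_real_iff) auto
  moreover have "(\<lambda>j. norm (\<Sum>n. norm (f j n))) summable_on UNIV"
    using assms by (subst summable_on_UNIV_nonneg_real_iff) (auto simp: suminf_nonneg)
  ultimately show ?thesis
    using Infinite_Sum.abs_summable_on_Sigma_iff[where f = "case_prod f" and A = UNIV and B = "\<lambda>_. UNIV"] by (simp add: eq)
qed

lemma iterated_series_has_sum:
  fixes f :: "nat \<Rightarrow> nat \<Rightarrow> complex"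
  assumes "\<And>j. summable (\<lambda>n. norm (f j n))"
    and "summable (\<lambda>j. \<Sum>n. norm (f j n))"
  shows "(case_prod f has_sum (\<Sum>j. \<Sum>n. f j n)) (UNIV \<times> UNIV)"
proof -
  obtain S where S: "(case_prod f has_sum S) (UNIV \<times> UNIV)"
    using abs_summable_summable[OF abs_summable_iterated_series[OF assms]] by (auto simp: summable_on_def)
  have row: "(f j has_sum (\<Sum>n. f j n)) UNIV" for j
    using assms(1)[of j]
    by (intro norm_summable_imp_has_sum) (auto intro: summable_sums summable_norm_cancel)
  have "((\<lambda>j. \<Sum>n. f j n) has_sum S) UNIV"
    by (rule has_sum_SigmaD[OF S]) (use row in auto)
  then have "S = (\<Sum>j. \<Sum>n. f j n)"
    using has_sum_imp_sums sums_unique by blast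
  with S show ?thesis by simp
qed

lemma iterated_series_swap:
  fixes f :: "nat \<Rightarrow> nat \<Rightarrow> complex"
  assumes "\<And>j. summable (\<lambda>n. norm (f j n))"
    and "summable (\<lambda>j. \<Sum>n. norm (f j n))"
  shows "(\<lambda>n. \<Sum>j. f j n) sums (\<Sum>j. \<Sum>n. f j n)"
proof -
  let ?F = "case_prod f" and ?G = "\<lambda>(n, j). f j n"
  define S where "S = (\<Sum>j. \<Sum>n. f j n)"
  have S: "(?F has_sum S) (UNIV \<times> UNIV)" unfolding S_def by (rule iterated_series_has_sum[OF assms])
  have G: "(?G has_sum S) (UNIV \<times> UNIV)"
    using S by (subst (asm) has_sum_swap) (simp add: case_prod_unfold)
  then have "?G summable_on (UNIV \<times> UNIV)" by (auto simp: summable_on_def)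
  then have col: "(\<lambda>j. f j n) summable_on UNIV" for n
    using summable_on_SigmaD1[of "\<lambda>n j. f j n" UNIV "\<lambda>_. UNIV" n] by auto
  have col_sum: "((\<lambda>j. f j n) has_sum (\<Sum>j. f j n)) UNIV" for n
    using has_sum_infsum[OF col[of n]] has_sum_imp_sums[OF has_sum_infsum[OF col[of n]]] sums_unique
    by metis
  have "((\<lambda>n. \<Sum>j. f j n) has_sum S) UNIV"
    by (rule has_sum_SigmaD[OF G]) (use col_sum in auto)
  then show "(\<lambda>n. \<Sum>j. f j n) sums (\<Sum>j. \<Sum>n. f j n)"
    unfolding S_def [symmetric] by (rule has_sum_imp_sums)
qed

text \<open>
  The pairs \<open>(j, n)\<close> are regrouped by \<open>k = j + n\<close>, as for a Cauchy product of series.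
\<close>

lemma iterated_series_diagonal:
  fixes f :: "nat \<Rightarrow> nat \<Rightarrow> complex"
  assumes "\<And>j. summable (\<lambda>n. norm (f j n))"
    and "summable (\<lambda>j. \<Sum>n. norm (f j n))"
  shows "summable (\<lambda>k. norm (\<Sum>j=0..k. f j (k - j)))"
    and "(\<lambda>k. \<Sum>j=0..k. f j (k - j)) sums (\<Sum>j. \<Sum>n. f j n)"
proof -
  note abs = abs_summable_iterated_series[OF assms]
  let ?F = "case_prod f" and ?h = "\<lambda>(k, j). (j, k - j)"
  let ?T = "Sigma UNIV (\<lambda>k::nat. {0..k})"
  have bij: "bij_betw ?h ?T (UNIV \<times> UNIV)"
    by (rule bij_betwI[of _ _ _ "\<lambda>(j, n). (j + n, j)"]) auto
  define S where "S = (\<Sum>j. \<Sum>n. f j n)"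
  have S: "(?F has_sum S) (UNIV \<times> UNIV)" unfolding S_def by (rule iterated_series_has_sum[OF assms])
  have "((\<lambda>x. ?F (?h x)) has_sum S) ?T"
    using S by (subst has_sum_reindex_bij_betw[OF bij])
  then have "((\<lambda>k. \<Sum>j=0..k. f j (k - j)) has_sum S) UNIV"
    by (rule has_sum_SigmaD) (auto intro!: has_sum_finiteI)
  then show "(\<lambda>k. \<Sum>j=0..k. f j (k - j)) sums (\<Sum>j. \<Sum>n. f j n)"
    unfolding S_def [symmetric] by (rule has_sum_imp_sums)
  obtain N where N: "((\<lambda>x. norm (?F x)) has_sum N) (UNIV \<times> UNIV)"
    using abs by (auto simp: summable_on_def)
  have "((\<lambda>x. norm (?F (?h x))) has_sum N) ?T"
    using N by (subst has_sum_reindex_bij_betw[OF bij, of "\<lambda>x. norm (?F x)"])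
  then have "((\<lambda>k. \<Sum>j=0..k. norm (f j (k - j))) has_sum N) UNIV"
    by (rule has_sum_SigmaD) (auto intro!: has_sum_finiteI)
  then have "summable (\<lambda>k. \<Sum>j=0..k. norm (f j (k - j)))"
    using has_sum_imp_sums sums_summable by blast
  then show "summable (\<lambda>k. norm (\<Sum>j=0..k. f j (k - j)))"
    by (rule summable_comparison_test'[where N = 0]) (simp add: norm_sum)
qed

section \<open>Growth of Pochhammer symbols and of shifted reciprocal Gamma values\<close>

lemma Re_pos_not_nonpos_Ints: "Re z > 0 \<Longrightarrow> z \<notin> \<int>\<^sub>\<le>\<^sub>0"
  by (metis Re_complex_of_real linorder_not_less nonpos_Ints_cases of_int_le_0_iff of_real_of_int_eq)

lemma of_nat_neq_eventually: "eventually (\<lambda>n. z + of_nat n \<noteq> (0 :: complex)) sequentially"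
proof -
  obtain N :: nat where N: "norm z < real N" using reals_Archimedean2 by blast
  have "z + of_nat n \<noteq> 0" if "n \<ge> N" for n
  proof
    assume "z + of_nat n = 0"
    then have "z = - of_nat n" by (simp add: add_eq_0_iff2)
    then show False using N that by simp
  qed
  then show ?thesis by (rule eventually_sequentiallyI)
qed

lemma tendsto_one_plus_over_of_nat: "(\<lambda>n. 1 + z / of_nat n) \<longlonglongrightarrow> (1 :: complex)"
  using tendsto_add[OF tendsto_const[of 1] tendsto_divide_0[OF tendsto_const[of z] tendsto_of_nat]] by simp

lemma pochhammer_asymp:
  "(\<lambda>n. pochhammer z n / (fact n * of_nat n powr (z - 1))) \<longlonglongrightarrow> rGamma (z :: complex)"
proof -
  have lim: "(\<lambda>n. rGamma_series z n / (1 + z / of_nat n)) \<longlonglongrightarrow> rGamma z / 1"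
    by (intro tendsto_divide rGamma_series_LIMSEQ tendsto_one_plus_over_of_nat) auto
  have ev: "eventually (\<lambda>n. rGamma_series z n / (1 + z / of_nat n) =
      pochhammer z n / (fact n * of_nat n powr (z - 1))) sequentially"
    using eventually_gt_at_top[of 0] of_nat_neq_eventually[of z]
  proof eventually_elim
    case (elim n)
    have n: "of_nat n \<noteq> (0 :: complex)" using elim by simp
    have e: "exp (z * of_real (ln (real n))) = of_nat n powr z"
      using elim by (simp add: powr_def Ln_of_nat)
    have nz: "of_nat n powr z \<noteq> 0" using n by simp
    have p: "of_nat n powr (z - 1) = of_nat n powr z / of_nat n" using n by (simp add: powr_diff)
    have q: "1 + z / of_nat n = (z + of_nat n) / of_nat n" using n by (simp add: add_divide_distrib)
    show ?case
      unfolding rGamma_series_def e p q using n nz elim(2) by (simp add: pochhammer_Suc)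
  qed
  from Lim_transform_eventually[OF lim ev] show ?thesis by simp
qed

text \<open>
  Away from the poles this is the reciprocal of \<open>pochhammer_asymp\<close>. The functional equation carries it
  from \<open>z + 1\<close> to \<open>z\<close>, so it persists where \<open>rGamma z = 0\<close>.
\<close>

lemma rGamma_shift_asymp:
  "(\<lambda>n. rGamma (z + of_nat n) * fact n * of_nat n powr (z - 1)) \<longlonglongrightarrow> (1 :: complex)"
proof -
  let ?g = "\<lambda>z n. rGamma (z + of_nat n) * fact n * of_nat n powr (z - 1) :: complex"
  have base: "?g z \<longlonglongrightarrow> 1" if z: "z \<notin> \<int>\<^sub>\<le>\<^sub>0" for z
  proof -
    have r: "rGamma z \<noteq> 0" using z by (simp add: rGamma_eq_zero_iff)
    have "(\<lambda>n. rGamma z / (pochhammer z n / (fact n * of_nat n powr (z - 1)))) \<longlonglongrightarrow> rGamma z / rGamma z"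
      by (intro tendsto_divide pochhammer_asymp tendsto_const r)
    moreover have "rGamma z / (pochhammer z n / (fact n * of_nat n powr (z - 1))) = ?g z n" for n
    proof -
      have "pochhammer z n \<noteq> 0" using z pochhammer_eq_0_imp_nonpos_Int by blast
      then show ?thesis using pochhammer_rGamma[of z n] by simp
    qed
    ultimately show ?thesis using r by simp
  qed
  have shift: "?g z \<longlonglongrightarrow> 1" if "?g (z + 1) \<longlonglongrightarrow> 1" for z
  proof -
    have lim: "(\<lambda>n. ?g (z + 1) n * (1 + z / of_nat n)) \<longlonglongrightarrow> 1 * 1"
      by (intro tendsto_mult that tendsto_one_plus_over_of_nat)
    have ev: "eventually (\<lambda>n. ?g (z + 1) n * (1 + z / of_nat n) = ?g z n) sequentially"
      using eventually_gt_at_top[of 0]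
    proof eventually_elim
      case (elim n)
      have n: "of_nat n \<noteq> (0 :: complex)" using elim by simp
      have r: "rGamma (z + of_nat n) = (z + of_nat n) * rGamma (z + 1 + of_nat n)"
        using rGamma_plus1[of "z + of_nat n"] by (simp add: add_ac)
      have p: "of_nat n powr (z - 1) = of_nat n powr z / of_nat n" using n by (simp add: powr_diff)
      have q: "1 + z / of_nat n = (z + of_nat n) / of_nat n" using n by (simp add: add_divide_distrib)
      show ?case unfolding r p q by simp
    qed
    from Lim_transform_eventually[OF lim ev] show ?thesis by simp
  qed
  have step: "?g z \<longlonglongrightarrow> 1" if "z + of_nat K \<notin> \<int>\<^sub>\<le>\<^sub>0" for z K
    using that
  proof (induction K arbitrary: z)
    case (Suc K)
    have "?g (z + 1) \<longlonglongrightarrow> 1" by (rule Suc.IH) (use Suc.prems in \<open>simp add: add_ac\<close>)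
    then show ?case by (rule shift)
  qed (use base in simp)
  obtain K :: nat where "norm z < real K" using reals_Archimedean2 by blast
  then have "Re (z + of_nat K) > 0" using abs_Re_le_cmod[of z] by simp
  then have "z + of_nat K \<notin> \<int>\<^sub>\<le>\<^sub>0" by (rule Re_pos_not_nonpos_Ints)
  then show ?thesis by (rule step)
qed

lemma tendsto_zero_of_powr_limit:
  fixes f :: "nat \<Rightarrow> complex"
  assumes "(\<lambda>n. f n * of_nat n powr s) \<longlonglongrightarrow> L" "Re s > 0"
  shows "f \<longlonglongrightarrow> 0"
proof -
  have "(\<lambda>n. real n powr (- Re s)) \<longlonglongrightarrow> 0"
    using assms(2) by (intro tendsto_neg_powr filterlim_real_sequentially) auto
  then have "(\<lambda>n. norm (of_nat n powr (- s) :: complex)) \<longlonglongrightarrow> 0"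
    by (rule Lim_transform_eventually)
       (auto intro!: eventually_sequentiallyI[of 1] simp: norm_powr_real_powr)
  then have "(\<lambda>n. f n * of_nat n powr s * of_nat n powr (- s)) \<longlonglongrightarrow> L * 0"
    by (intro tendsto_mult assms(1)) (simp add: tendsto_norm_zero_iff)
  moreover have "eventually (\<lambda>n. f n * of_nat n powr s * of_nat n powr (- s) = f n) sequentially"
    using eventually_gt_at_top[of 0] by eventually_elim (simp add: powr_minus)
  ultimately show ?thesis using Lim_transform_eventually by force
qed

lemma norm_le_of_powr_limit:
  fixes f :: "nat \<Rightarrow> complex"
  assumes "(\<lambda>n. f n * of_nat n powr s) \<longlonglongrightarrow> L"
  obtains C where "C > 0" "\<And>n. n > 0 \<Longrightarrow> norm (f n) \<le> C * real n powr (- Re s)"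
proof -
  obtain C where C: "C > 0" "\<And>n. norm (f n * of_nat n powr s) \<le> C"
    using convergent_imp_Bseq[OF convergentI[OF assms]] by (auto elim: BseqE)
  have "norm (f n) \<le> C * real n powr (- Re s)" if "n > 0" for n
  proof -
    have "norm (f n) * real n powr Re s \<le> C"
      using C(2)[of n] that by (simp add: norm_mult norm_powr_real_powr)
    then show ?thesis using that by (simp add: powr_minus field_simps)
  qed
  with C(1) show ?thesis using that by blast
qed

lemma summable_norm_of_powr_limit:
  fixes f :: "nat \<Rightarrow> complex"
  assumes "(\<lambda>n. f n * of_nat n powr s) \<longlonglongrightarrow> L" "Re s > 1"
  shows "summable (\<lambda>n. norm (f n))"
proof -
  obtain C where C: "\<And>n. n > 0 \<Longrightarrow> norm (f n) \<le> C * real n powr (- Re s)"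
    using norm_le_of_powr_limit[OF assms(1)] by metis
  have "summable (\<lambda>n. C * real n powr (- Re s))"
    using assms(2) by (intro summable_mult) (simp add: summable_real_powr_iff)
  then show ?thesis
    by (rule summable_comparison_test'[where N = 1]) (use C in auto)
qed

text \<open>
  The quotient of the two sides is a product of \<open>N\<close> factors \<open>|z + i + k| / |z + i + n|\<close>, each at most
  one because \<open>Re z > 0\<close>. This is the uniform tail bound for factorial series: their tails
  beyond index \<open>k\<close> decay at the rate of their \<open>k\<close>-th term when the argument is shifted by \<open>N\<close>.
\<close>

lemma rGamma_shift_ratio_le:
  fixes z :: complex
  assumes "Re z > 0" "k \<le> n"
  shows "norm (rGamma (z + of_nat N + of_nat n)) * norm (rGamma (z + of_nat k))
         \<le> norm (rGamma (z + of_nat n)) * norm (rGamma (z + of_nat N + of_nat k))"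
proof (induction N)
  case (Suc N)
  have nz: "z + of_nat N + of_nat j \<noteq> 0" for j
    using assms(1) by (auto simp: complex_eq_iff)
  have rec: "norm (rGamma (z + of_nat (Suc N) + of_nat j)) =
      norm (rGamma (z + of_nat N + of_nat j)) / norm (z + of_nat N + of_nat j)" for j
  proof -
    have "norm (rGamma (z + of_nat N + of_nat j)) =
        norm (z + of_nat N + of_nat j) * norm (rGamma (z + of_nat (Suc N) + of_nat j))"
      using rGamma_plus1[of "z + of_nat N + of_nat j"] by (simp add: add_ac flip: norm_mult)
    then show ?thesis using nz[of j] by simp
  qed
  have le: "norm (z + of_nat N + of_nat k) \<le> norm (z + of_nat N + of_nat n)"
    unfolding cmod_def using assms by (intro real_sqrt_le_mono add_right_mono power_mono) auto
  have pos: "norm (z + of_nat N + of_nat k) > 0" using nz[of k] by simp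
  have "norm (rGamma (z + of_nat (Suc N) + of_nat n)) * norm (rGamma (z + of_nat k)) =
      norm (rGamma (z + of_nat N + of_nat n)) * norm (rGamma (z + of_nat k)) / norm (z + of_nat N + of_nat n)"
    unfolding rec by simp
  also have "\<dots> \<le> norm (rGamma (z + of_nat n)) * norm (rGamma (z + of_nat N + of_nat k)) / norm (z + of_nat N + of_nat k)"
    using Suc.IH le pos by (intro frac_le mult_nonneg_nonneg) auto
  also have "\<dots> = norm (rGamma (z + of_nat n)) * norm (rGamma (z + of_nat (Suc N) + of_nat k))"
    unfolding rec by simp
  finally show ?case .
qed (simp add: mult.commute)

section \<open>Gauss's summation theorem\<close>

definition gauss_term :: "complex \<Rightarrow> complex \<Rightarrow> complex \<Rightarrow> nat \<Rightarrow> complex" where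
  "gauss_term \<alpha> \<beta> \<gamma> n = pochhammer \<alpha> n * pochhammer \<beta> n / fact n * rGamma (\<gamma> + of_nat n)"

lemma gauss_term_asymp:
  "(\<lambda>n. gauss_term \<alpha> \<beta> \<gamma> n * of_nat n powr (1 + (\<gamma> - \<alpha> - \<beta>))) \<longlonglongrightarrow> rGamma \<alpha> * rGamma \<beta>"
proof -
  have lim: "(\<lambda>n. (pochhammer \<alpha> n / (fact n * of_nat n powr (\<alpha> - 1))) * (pochhammer \<beta> n / (fact n * of_nat n powr (\<beta> - 1)))
      * (rGamma (\<gamma> + of_nat n) * fact n * of_nat n powr (\<gamma> - 1))) \<longlonglongrightarrow> rGamma \<alpha> * rGamma \<beta> * 1"
    by (intro tendsto_mult pochhammer_asymp rGamma_shift_asymp)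
  have ev: "eventually (\<lambda>n. (pochhammer \<alpha> n / (fact n * of_nat n powr (\<alpha> - 1))) * (pochhammer \<beta> n / (fact n * of_nat n powr (\<beta> - 1)))
      * (rGamma (\<gamma> + of_nat n) * fact n * of_nat n powr (\<gamma> - 1)) =
      gauss_term \<alpha> \<beta> \<gamma> n * of_nat n powr (1 + (\<gamma> - \<alpha> - \<beta>))) sequentially"
    using eventually_gt_at_top[of 0]
  proof eventually_elim
    case (elim n)
    have nz: "of_nat n powr (\<alpha> - 1) \<noteq> (0::complex)" "of_nat n powr (\<beta> - 1) \<noteq> (0::complex)" using elim by auto
    have "of_nat n powr (\<gamma> - 1) = of_nat n powr (1 + (\<gamma> - \<alpha> - \<beta>)) * of_nat n powr (\<alpha> - 1) * (of_nat n powr (\<beta> - 1) :: complex)"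
      by (simp flip: powr_add)
    then show ?case using nz by (simp add: gauss_term_def)
  qed
  from Lim_transform_eventually[OF lim ev] show ?thesis by simp
qed

lemma summable_norm_gauss_term:
  "Re (\<gamma> - \<alpha> - \<beta>) > 0 \<Longrightarrow> summable (\<lambda>n. norm (gauss_term \<alpha> \<beta> \<gamma> n))"
  by (rule summable_norm_of_powr_limit[OF gauss_term_asymp]) simp

text \<open>
  The quantities \<open>n t\<^sub>n\<close>, with \<open>t\<^sub>n\<close> the summand on the left, have differences equal to the
  difference of the two sides, term by term, and they tend to zero since \<open>t\<^sub>n\<close> has order \<open>n\<^sup>-\<^sup>1\<^sup>-\<^sup>a\<close>.
\<close>

lemma gauss_contiguous:
  assumes "Re a > 0"
  shows "a * (\<Sum>n. gauss_term \<alpha> \<beta> (\<alpha> + \<beta> + a) n) =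
         (a + \<alpha>) * (a + \<beta>) * (\<Sum>n. gauss_term \<alpha> \<beta> (\<alpha> + \<beta> + (a + 1)) n)"
proof -
  let ?t = "\<lambda>a. gauss_term \<alpha> \<beta> (\<alpha> + \<beta> + a)"
  define w where "w n = of_nat n * ?t a n" for n
  have "(\<lambda>n. w n * of_nat n powr a) \<longlonglongrightarrow> rGamma \<alpha> * rGamma \<beta>"
  proof -
    have ev: "eventually (\<lambda>n. ?t a n * of_nat n powr (1 + (\<alpha> + \<beta> + a - \<alpha> - \<beta>)) = w n * of_nat n powr a) sequentially"
      using eventually_gt_at_top[of 0] by eventually_elim (simp add: w_def powr_add)
    show ?thesis by (rule Lim_transform_eventually[OF gauss_term_asymp ev])
  qed
  then have "w \<longlonglongrightarrow> 0" by (rule tendsto_zero_of_powr_limit) (use assms in auto)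
  then have "(\<lambda>n. w (Suc n) - w n) sums (0 - w 0)" by (rule telescope_sums)
  moreover have "w (Suc n) - w n = (a + \<alpha>) * (a + \<beta>) * ?t (a + 1) n - a * ?t a n" for n
  proof -
    define R where "R = rGamma (\<alpha> + \<beta> + a + of_nat (Suc n))"
    have r: "rGamma (\<alpha> + \<beta> + a + of_nat n) = (\<alpha> + \<beta> + a + of_nat n) * R"
      using rGamma_plus1[of "\<alpha> + \<beta> + a + of_nat n"] by (simp add: R_def add_ac)
    have r': "rGamma (\<alpha> + \<beta> + (a + 1) + of_nat n) = R" by (simp add: R_def add_ac)
    have s: "of_nat (Suc n) * (pochhammer \<alpha> (Suc n) * pochhammer \<beta> (Suc n) / fact (Suc n)) =
        pochhammer \<alpha> n * pochhammer \<beta> n / fact n * ((\<alpha> + of_nat n) * (\<beta> + of_nat n))"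
    proof -
      have "of_nat (Suc n) \<noteq> (0::complex)" by (rule of_nat_neq_0)
      then show ?thesis by (simp add: pochhammer_Suc del: of_nat_Suc)
    qed
    define P where "P = pochhammer \<alpha> n * pochhammer \<beta> n / fact n"
    have "w (Suc n) = P * ((\<alpha> + of_nat n) * (\<beta> + of_nat n)) * R"
      unfolding w_def gauss_term_def R_def P_def s [symmetric] by (simp only: mult.assoc)
    moreover have "w n = of_nat n * (P * ((\<alpha> + \<beta> + a + of_nat n) * R))" "?t a n = P * ((\<alpha> + \<beta> + a + of_nat n) * R)"
      "?t (a + 1) n = P * R"
      unfolding w_def gauss_term_def r r' P_def by simp_all
    ultimately show ?thesis by (simp only:) (simp add: algebra_simps)
  qed
  ultimately have "(\<lambda>n. (a + \<alpha>) * (a + \<beta>) * ?t (a + 1) n - a * ?t a n) sums 0"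
    by (simp add: w_def)
  moreover have "summable (?t a)" "summable (?t (a + 1))"
    using assms by (auto intro!: summable_norm_cancel[OF summable_norm_gauss_term])
  then have "(\<lambda>n. (a + \<alpha>) * (a + \<beta>) * ?t (a + 1) n - a * ?t a n) sums
      ((a + \<alpha>) * (a + \<beta>) * (\<Sum>n. ?t (a + 1) n) - a * (\<Sum>n. ?t a n))"
    by (intro sums_diff sums_mult summable_sums)
  ultimately have "0 = (a + \<alpha>) * (a + \<beta>) * (\<Sum>n. ?t (a + 1) n) - a * (\<Sum>n. ?t a n)"
    by (rule sums_unique2)
  then show ?thesis by simp
qed

lemma gauss_contiguous_iterate:
  assumes "Re a > 0"
  shows "pochhammer a N * (\<Sum>n. gauss_term \<alpha> \<beta> (\<alpha> + \<beta> + a) n) =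
         pochhammer (a + \<alpha>) N * pochhammer (a + \<beta>) N * (\<Sum>n. gauss_term \<alpha> \<beta> (\<alpha> + \<beta> + (a + of_nat N)) n)"
proof (induction N)
  case (Suc N)
  let ?G = "\<lambda>a. \<Sum>n. gauss_term \<alpha> \<beta> (\<alpha> + \<beta> + a) n"
  have "pochhammer a (Suc N) * ?G a = (a + of_nat N) * (pochhammer a N * ?G a)"
    by (simp add: pochhammer_Suc)
  also have "\<dots> = pochhammer (a + \<alpha>) N * pochhammer (a + \<beta>) N * ((a + of_nat N) * ?G (a + of_nat N))"
    unfolding Suc.IH by (simp only: mult_ac)
  also have "(a + of_nat N) * ?G (a + of_nat N) =
      (a + of_nat N + \<alpha>) * (a + of_nat N + \<beta>) * ?G (a + of_nat (Suc N))"
    using assms gauss_contiguous[of "a + of_nat N" \<alpha> \<beta>] by (simp add: add_ac)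
  finally show ?case by (simp only: pochhammer_Suc ac_simps)
qed simp

text \<open>
  For large \<open>N\<close> only the term \<open>n = 0\<close> of the series matters: by \<open>rGamma_shift_ratio_le\<close> the remaining
  terms together are of the order of the term \<open>n = 1\<close>, which is smaller by a factor \<open>N\<close>.
\<close>

lemma gauss_sum_shift_asymp:
  assumes "Re a > 0" and c: "c = \<alpha> + \<beta> + a"
  shows "(\<lambda>N. (\<Sum>n. gauss_term \<alpha> \<beta> (c + of_nat N) n) * fact N * of_nat N powr (c - 1)) \<longlonglongrightarrow> 1"
proof -
  let ?t = "\<lambda>N. gauss_term \<alpha> \<beta> (c + of_nat N)"
  define T where "T N = (\<Sum>n. ?t N (Suc n))" for N
  have summ: "summable (\<lambda>n. norm (?t N n))" for N
    using assms c by (intro summable_norm_gauss_term) auto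
  have split: "(\<Sum>n. ?t N n) = rGamma (c + of_nat N) + T N" for N
    using suminf_split_head[OF summable_norm_cancel[OF summ[of N]]]
    by (simp add: T_def gauss_term_def)
  obtain N0 :: nat where N0: "Re (c + of_nat N0) > 0"
  proof -
    obtain N0 :: nat where "norm c < real N0" using reals_Archimedean2 by blast
    then show ?thesis using that[of N0] abs_Re_le_cmod[of c] by simp
  qed
  define z where "z = c + of_nat N0"
  have "z + 1 \<notin> \<int>\<^sub>\<le>\<^sub>0" by (rule Re_pos_not_nonpos_Ints) (use N0 in \<open>simp add: z_def\<close>)
  then have rz: "norm (rGamma (z + 1)) > 0" unfolding zero_less_norm_iff rGamma_eq_zero_iff .
  define B where "B = (\<Sum>n. norm (?t N0 (Suc n))) / norm (rGamma (z + 1))"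
  have bound: "norm (T N) \<le> B * norm (rGamma (c + 1 + of_nat N))" if N: "N \<ge> N0" for N
  proof -
    obtain M where M: "N = N0 + M" using le_Suc_ex[OF N] by blast
    have le: "norm (?t N (Suc n)) \<le> norm (?t N0 (Suc n)) * (norm (rGamma (c + 1 + of_nat N)) / norm (rGamma (z + 1)))" for n
    proof -
      have ratio: "norm (rGamma (z + of_nat M + of_nat (Suc n))) * norm (rGamma (z + of_nat 1))
          \<le> norm (rGamma (z + of_nat (Suc n))) * norm (rGamma (z + of_nat M + of_nat 1))"
        by (rule rGamma_shift_ratio_le) (use N0 in \<open>auto simp: z_def\<close>)
      have "norm (rGamma (c + of_nat N + of_nat (Suc n)))
          \<le> norm (rGamma (c + of_nat N0 + of_nat (Suc n))) * (norm (rGamma (c + 1 + of_nat N)) / norm (rGamma (z + 1)))"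
      proof -
        have e: "z + of_nat M + of_nat (Suc n) = c + of_nat N + of_nat (Suc n)"
          "z + of_nat (Suc n) = c + of_nat N0 + of_nat (Suc n)"
          "z + of_nat M + of_nat 1 = c + 1 + of_nat N" "z + of_nat 1 = z + 1"
          by (simp_all add: z_def M)
        show ?thesis using ratio rz unfolding e by (simp add: pos_le_divide_eq)
      qed
      then have "norm (pochhammer \<alpha> (Suc n) * pochhammer \<beta> (Suc n) / fact (Suc n)) * norm (rGamma (c + of_nat N + of_nat (Suc n)))
          \<le> norm (pochhammer \<alpha> (Suc n) * pochhammer \<beta> (Suc n) / fact (Suc n)) *
             (norm (rGamma (c + of_nat N0 + of_nat (Suc n))) * (norm (rGamma (c + 1 + of_nat N)) / norm (rGamma (z + 1))))"
        by (rule mult_left_mono) simp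
      then show ?thesis by (simp only: gauss_term_def norm_mult mult.assoc)
    qed
    have s: "summable (\<lambda>n. norm (?t N (Suc n)))" for N
      using summ[of N] by (subst summable_Suc_iff)
    have "norm (T N) \<le> (\<Sum>n. norm (?t N (Suc n)))" unfolding T_def by (rule summable_norm[OF s])
    also have "\<dots> \<le> (\<Sum>n. norm (?t N0 (Suc n)) * (norm (rGamma (c + 1 + of_nat N)) / norm (rGamma (z + 1))))"
      by (intro suminf_le le s summable_mult2)
    also have "\<dots> = B * norm (rGamma (c + 1 + of_nat N))"
      unfolding B_def suminf_mult2[OF s[of N0], symmetric] by simp
    finally show ?thesis .
  qed
  let ?h = "\<lambda>N. rGamma (c + 1 + of_nat N) * fact N * of_nat N powr (c - 1) :: complex"
  have h: "?h \<longlonglongrightarrow> 0"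
  proof -
    have lim: "(\<lambda>N. rGamma (c + 1 + of_nat N) * fact N * of_nat N powr (c + 1 - 1) * (1 / of_nat N)) \<longlonglongrightarrow> 1 * 0"
      by (intro tendsto_mult rGamma_shift_asymp tendsto_divide_0[OF tendsto_const] tendsto_of_nat)
    have ev: "eventually (\<lambda>N. rGamma (c + 1 + of_nat N) * fact N * of_nat N powr (c + 1 - 1) * (1 / of_nat N) = ?h N) sequentially"
      using eventually_gt_at_top[of 0] by eventually_elim (simp add: powr_diff)
    from Lim_transform_eventually[OF lim ev] show ?thesis by simp
  qed
  have "(\<lambda>N. T N * fact N * of_nat N powr (c - 1)) \<longlonglongrightarrow> 0"
  proof (rule Lim_null_comparison)
    show "(\<lambda>N. B * norm (?h N)) \<longlonglongrightarrow> 0"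
      using tendsto_mult_right_zero[OF tendsto_norm_zero[OF h]] .
    show "eventually (\<lambda>N. norm (T N * fact N * of_nat N powr (c - 1)) \<le> B * norm (?h N)) sequentially"
      using eventually_ge_at_top[of N0]
    proof eventually_elim
      case (elim N)
      from mult_right_mono[OF bound[OF elim], of "norm (fact N * of_nat N powr (c - 1) :: complex)"]
      show ?case by (simp add: norm_mult mult_ac)
    qed
  qed
  from tendsto_add[OF rGamma_shift_asymp[of c] this]
  show ?thesis by (simp add: split distrib_right)
qed

text \<open>
  Iterating \<open>gauss_contiguous\<close> moves \<open>a\<close> to \<open>a + N\<close>; the limit \<open>N \<rightarrow> \<infinity>\<close> evaluates the Pochhammer factors
  by \<open>pochhammer_asymp\<close> and the remaining sum by \<open>gauss_sum_shift_asymp\<close>. With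
  \<open>\<gamma> = \<alpha> + \<beta> + a\<close> this is the classical value at the point one of the hypergeometric series, divided by \<open>\<Gamma>(\<gamma>)\<close>, which makes
  both sides entire in \<open>\<alpha>\<close> and \<open>\<beta>\<close>.
\<close>

theorem gauss_summation:
  assumes "Re a > 0"
  shows "gauss_term \<alpha> \<beta> (\<alpha> + \<beta> + a) sums (Gamma a * rGamma (a + \<alpha>) * rGamma (a + \<beta>))"
proof -
  let ?G = "\<lambda>a. \<Sum>n. gauss_term \<alpha> \<beta> (\<alpha> + \<beta> + a) n"
  let ?P = "\<lambda>z N. pochhammer z N / (fact N * of_nat N powr (z - 1)) :: complex"
  let ?c = "\<alpha> + \<beta> + a"
  have lim1: "(\<lambda>N. ?P a N * ?G a) \<longlonglongrightarrow> rGamma a * ?G a"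
    by (intro tendsto_mult pochhammer_asymp tendsto_const)
  have lim2: "(\<lambda>N. ?P (a + \<alpha>) N * ?P (a + \<beta>) N * ((\<Sum>n. gauss_term \<alpha> \<beta> (?c + of_nat N) n) * fact N * of_nat N powr (?c - 1)))
      \<longlonglongrightarrow> rGamma (a + \<alpha>) * rGamma (a + \<beta>) * 1"
    by (intro tendsto_mult pochhammer_asymp gauss_sum_shift_asymp[OF assms refl])
  have ev: "eventually (\<lambda>N. ?P (a + \<alpha>) N * ?P (a + \<beta>) N * ((\<Sum>n. gauss_term \<alpha> \<beta> (?c + of_nat N) n) * fact N * of_nat N powr (?c - 1))
      = ?P a N * ?G a) sequentially"
    using eventually_gt_at_top[of 0]
  proof eventually_elim
    case (elim N)
    have nz: "of_nat N powr (a + \<alpha> - 1) \<noteq> (0::complex)" "of_nat N powr (a + \<beta> - 1) \<noteq> (0::complex)"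
      "of_nat N powr (a - 1) \<noteq> (0::complex)" using elim by auto
    have p: "of_nat N powr (?c - 1) * of_nat N powr (a - 1) = of_nat N powr (a + \<alpha> - 1) * (of_nat N powr (a + \<beta> - 1) :: complex)"
      by (simp add: algebra_simps flip: powr_add)
    have "?P a N * ?G a = pochhammer a N * ?G a / (fact N * of_nat N powr (a - 1))" by simp
    also have "\<dots> = pochhammer (a + \<alpha>) N * pochhammer (a + \<beta>) N * (\<Sum>n. gauss_term \<alpha> \<beta> (?c + of_nat N) n) / (fact N * of_nat N powr (a - 1))"
      unfolding gauss_contiguous_iterate[OF assms, of N] by (simp add: add_ac)
    also have "\<dots> = ?P (a + \<alpha>) N * ?P (a + \<beta>) N * ((\<Sum>n. gauss_term \<alpha> \<beta> (?c + of_nat N) n) * fact N * of_nat N powr (?c - 1))"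
    proof -
      have cancel: "x * y * s / (f * a3) = x / (f * a1) * (y / (f * a2)) * (s * f * (a1 * a2 / a3))"
        if "f \<noteq> 0" "a1 \<noteq> 0" "a2 \<noteq> 0" "a3 \<noteq> 0" for x y s f a1 a2 a3 :: complex
        using that by (simp add: divide_simps)
      have pw: "of_nat N powr (?c - 1) = of_nat N powr (a + \<alpha> - 1) * of_nat N powr (a + \<beta> - 1) / (of_nat N powr (a - 1) :: complex)"
        using nz(3) p by (simp add: eq_divide_eq)
      show ?thesis unfolding pw by (rule cancel) (use nz in simp_all)
    qed
    finally show ?case ..
  qed
  have "rGamma a * ?G a = rGamma (a + \<alpha>) * rGamma (a + \<beta>)"
    using LIMSEQ_unique[OF lim1 Lim_transform_eventually[OF lim2 ev]] by simp
  moreover have "rGamma a \<noteq> 0" unfolding rGamma_eq_zero_iff by (rule Re_pos_not_nonpos_Ints[OF assms])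
  ultimately have "?G a = Gamma a * rGamma (a + \<alpha>) * rGamma (a + \<beta>)"
    by (simp add: Gamma_def field_simps)
  moreover have "summable (gauss_term \<alpha> \<beta> ?c)"
    using assms by (intro summable_norm_cancel[OF summable_norm_gauss_term]) auto
  ultimately show ?thesis using summable_sums by metis
qed

section \<open>Two operators on coefficients of inverse factorial series\<close>

text \<open>
  If \<open>f(l) = \<Sum>\<^sub>k A\<^sub>k / \<Gamma>(\<sigma> + l + k)\<close>, then the coefficients of \<open>(l + \<sigma> - 1 - d) f(l)\<close> with respect to the
  functions \<open>1 / \<Gamma>(\<sigma> - 1 + l + k)\<close> are those of \<open>lower_op d A\<close>.
\<close>

definition lower_op :: "complex \<Rightarrow> (nat \<Rightarrow> complex) \<Rightarrow> nat \<Rightarrow> complex" where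
  "lower_op d A k = (case k of 0 \<Rightarrow> A 0 | Suc i \<Rightarrow> A (Suc i) - (d + of_nat i) * A i)"

lemma lower_op_simps [simp]:
  "lower_op d A 0 = A 0"
  "lower_op d A (Suc k) = A (Suc k) - (d + of_nat k) * A k"
  by (simp_all add: lower_op_def)

definition gauss_kernel :: "complex \<Rightarrow> complex \<Rightarrow> nat \<Rightarrow> nat \<Rightarrow> complex" where
  "gauss_kernel c \<beta> j n = pochhammer (c + of_nat j) n * pochhammer \<beta> n / fact n"

text \<open>
  With \<open>c = \<sigma> - a\<close> and \<open>\<beta> = b - a\<close> this describes multiplication of a series in \<open>1 / \<Gamma>(\<sigma> + l + k)\<close> by
  \<open>\<Gamma>(a + l) / \<Gamma>(b + l)\<close>; the result is a series in \<open>1 / \<Gamma>(\<sigma> + \<beta> + l + k)\<close>.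
\<close>

definition gauss_op :: "complex \<Rightarrow> complex \<Rightarrow> (nat \<Rightarrow> complex) \<Rightarrow> nat \<Rightarrow> complex" where
  "gauss_op c \<beta> A k = (\<Sum>j=0..k. gauss_kernel c \<beta> j (k - j) * A j)"

lemma gauss_kernel_0 [simp]: "gauss_kernel c \<beta> j 0 = 1"
  by (simp add: gauss_kernel_def)

lemma fact_Suc_cancel: "x * of_nat (Suc n) / fact (Suc n) = x / (fact n :: complex)"
proof -
  have "of_nat (Suc n) \<noteq> (0 :: complex)" by (rule of_nat_neq_0)
  then show ?thesis by (simp del: of_nat_Suc)
qed

lemma gauss_kernel_Suc_beta:
  "gauss_kernel c \<beta> j (Suc n) =
   gauss_kernel c (\<beta> + 1) j (Suc n) - (c + of_nat j + of_nat n) * gauss_kernel c (\<beta> + 1) j n"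
proof -
  define P where "P = pochhammer (c + of_nat j) n * (c + of_nat j + of_nat n) * pochhammer (\<beta> + 1) n / fact (Suc n)"
  have "gauss_kernel c (\<beta> + 1) j n * (c + of_nat j + of_nat n) = P * of_nat (Suc n)"
    using fact_Suc_cancel[of "pochhammer (c + of_nat j) n * (c + of_nat j + of_nat n) * pochhammer (\<beta> + 1) n" n]
    by (simp add: gauss_kernel_def P_def del: of_nat_Suc fact_Suc)
  moreover have "gauss_kernel c (\<beta> + 1) j (Suc n) = P * (\<beta> + 1 + of_nat n)"
    by (simp add: gauss_kernel_def P_def pochhammer_Suc del: fact_Suc)
  moreover have "gauss_kernel c \<beta> j (Suc n) = P * \<beta>"
    unfolding gauss_kernel_def P_def pochhammer_rec[of \<beta>] pochhammer_Suc[of "c + of_nat j"]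
    by (simp del: fact_Suc)
  ultimately show ?thesis by (simp add: algebra_simps)
qed

lemma gauss_kernel_shift:
  "gauss_kernel c \<beta> j (Suc n) - (d + \<beta> + of_nat j + of_nat n) * gauss_kernel c \<beta> j n =
   gauss_kernel (c - 1) \<beta> j (Suc n) - (d + of_nat j) * gauss_kernel (c - 1) \<beta> (Suc j) n"
proof -
  define P where "P = pochhammer (c + of_nat j) n * pochhammer \<beta> n / fact (Suc n)"
  have k0: "gauss_kernel c \<beta> j n = P * of_nat (Suc n)"
    using fact_Suc_cancel[of "pochhammer (c + of_nat j) n * pochhammer \<beta> n" n]
    by (simp add: gauss_kernel_def P_def del: of_nat_Suc fact_Suc)
  have k1: "gauss_kernel (c - 1) \<beta> (Suc j) n = P * of_nat (Suc n)"
    unfolding k0 [symmetric] by (simp add: gauss_kernel_def)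
  have k2: "gauss_kernel c \<beta> j (Suc n) = P * (c + of_nat j + of_nat n) * (\<beta> + of_nat n)"
    by (simp add: gauss_kernel_def P_def pochhammer_Suc del: fact_Suc)
  have "pochhammer (c - 1 + of_nat j) (Suc n) = (c - 1 + of_nat j) * pochhammer (c + of_nat j) n"
    unfolding pochhammer_rec by (simp add: algebra_simps)
  then have k3: "gauss_kernel (c - 1) \<beta> j (Suc n) = P * (c - 1 + of_nat j) * (\<beta> + of_nat n)"
    by (simp add: gauss_kernel_def P_def pochhammer_Suc[of \<beta>] del: fact_Suc)
  show ?thesis unfolding k0 k1 k2 k3 by (simp add: algebra_simps)
qed

lemma gauss_op_Suc:
  "gauss_op c \<beta> A (Suc k) = (\<Sum>j=0..k. gauss_kernel c \<beta> j (Suc (k - j)) * A j) + A (Suc k)"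
proof -
  have "(\<Sum>j=0..k. gauss_kernel c \<beta> j (Suc k - j) * A j) = (\<Sum>j=0..k. gauss_kernel c \<beta> j (Suc (k - j)) * A j)"
    by (intro sum.cong refl) (simp add: Suc_diff_le)
  then show ?thesis by (simp add: gauss_op_def)
qed

text \<open>
  The factor \<open>1 / \<Gamma>(b + l)\<close> is \<open>(b + l) / \<Gamma>(b + 1 + l)\<close>, and multiplication by \<open>b + l\<close> is an instance of
  \<open>lower_op\<close>. Repeated use makes the real part of \<open>\<beta>\<close> positive.
\<close>

lemma gauss_op_lower: "gauss_op c \<beta> A = lower_op c (gauss_op c (\<beta> + 1) A)"
proof
  fix k
  show "gauss_op c \<beta> A k = lower_op c (gauss_op c (\<beta> + 1) A) k"
  proof (cases k)
    case (Suc i)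
    have "(\<Sum>j=0..i. gauss_kernel c \<beta> j (Suc (i - j)) * A j) =
        (\<Sum>j=0..i. gauss_kernel c (\<beta> + 1) j (Suc (i - j)) * A j - (c + of_nat i) * (gauss_kernel c (\<beta> + 1) j (i - j) * A j))"
    proof (intro sum.cong refl)
      fix j assume "j \<in> {0..i}"
      then have e: "c + of_nat j + of_nat (i - j) = c + (of_nat i :: complex)" by (simp add: of_nat_diff)
      show "gauss_kernel c \<beta> j (Suc (i - j)) * A j =
          gauss_kernel c (\<beta> + 1) j (Suc (i - j)) * A j - (c + of_nat i) * (gauss_kernel c (\<beta> + 1) j (i - j) * A j)"
        unfolding gauss_kernel_Suc_beta[of c \<beta>] e by (simp add: algebra_simps)
    qed
    also have "\<dots> = (\<Sum>j=0..i. gauss_kernel c (\<beta> + 1) j (Suc (i - j)) * A j) - (c + of_nat i) * gauss_op c (\<beta> + 1) A i"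
      by (simp add: sum_subtractf sum_distrib_left gauss_op_def)
    finally show ?thesis unfolding Suc lower_op_simps gauss_op_Suc by simp
  qed (simp add: gauss_op_def)
qed

text \<open>
  Both sides describe multiplication by the same linear factor and the same Gamma quotient. As the representing
  series need not converge, the identity is checked on the kernels.
\<close>

lemma lower_gauss_op_commute: "lower_op (d + \<beta>) (gauss_op c \<beta> A) = gauss_op (c - 1) \<beta> (lower_op d A)"
proof
  fix k
  show "lower_op (d + \<beta>) (gauss_op c \<beta> A) k = gauss_op (c - 1) \<beta> (lower_op d A) k"
  proof (cases k)
    case (Suc i)
    let ?\<kappa> = "gauss_kernel c \<beta>" and ?\<kappa>' = "gauss_kernel (c - 1) \<beta>"
    have "lower_op (d + \<beta>) (gauss_op c \<beta> A) k =
        (\<Sum>j=0..i. ?\<kappa> j (Suc (i - j)) * A j) - (d + \<beta> + of_nat i) * (\<Sum>j=0..i. ?\<kappa> j (i - j) * A j) + A (Suc i)"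
      unfolding Suc lower_op_simps gauss_op_Suc by (simp add: gauss_op_def)
    also have "\<dots> = (\<Sum>j=0..i. ?\<kappa> j (Suc (i - j)) * A j - (d + \<beta> + of_nat i) * (?\<kappa> j (i - j) * A j)) + A (Suc i)"
      by (simp add: sum_subtractf sum_distrib_left)
    also have "(\<Sum>j=0..i. ?\<kappa> j (Suc (i - j)) * A j - (d + \<beta> + of_nat i) * (?\<kappa> j (i - j) * A j)) =
        (\<Sum>j=0..i. ?\<kappa>' j (Suc (i - j)) * A j - (d + of_nat j) * ?\<kappa>' (Suc j) (i - j) * A j)"
    proof (intro sum.cong refl)
      fix j assume "j \<in> {0..i}"
      then have e: "d + \<beta> + of_nat i = d + \<beta> + of_nat j + (of_nat (i - j) :: complex)" by (simp add: of_nat_diff)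
      have "?\<kappa> j (Suc (i - j)) * A j - (d + \<beta> + of_nat i) * (?\<kappa> j (i - j) * A j) =
          (?\<kappa> j (Suc (i - j)) - (d + \<beta> + of_nat i) * ?\<kappa> j (i - j)) * A j" by (simp add: algebra_simps)
      also have "\<dots> = (?\<kappa>' j (Suc (i - j)) - (d + of_nat j) * ?\<kappa>' (Suc j) (i - j)) * A j"
        unfolding e gauss_kernel_shift by simp
      finally show "?\<kappa> j (Suc (i - j)) * A j - (d + \<beta> + of_nat i) * (?\<kappa> j (i - j) * A j) =
          ?\<kappa>' j (Suc (i - j)) * A j - (d + of_nat j) * ?\<kappa>' (Suc j) (i - j) * A j"
        by (simp add: algebra_simps)
    qed
    also have "\<dots> + A (Suc i) = gauss_op (c - 1) \<beta> A (Suc i) - (\<Sum>j=0..i. (d + of_nat j) * ?\<kappa>' (Suc j) (i - j) * A j)"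
      by (simp add: gauss_op_Suc sum_subtractf)
    also have "gauss_op (c - 1) \<beta> A (Suc i) = ?\<kappa>' 0 (Suc i) * A 0 + (\<Sum>j=0..i. ?\<kappa>' (Suc j) (i - j) * A (Suc j))"
      unfolding gauss_op_def sum.atLeast0_atMost_Suc_shift by simp
    also have "\<dots> - (\<Sum>j=0..i. (d + of_nat j) * ?\<kappa>' (Suc j) (i - j) * A j) =
        ?\<kappa>' 0 (Suc i) * A 0 + (\<Sum>j=0..i. ?\<kappa>' (Suc j) (i - j) * lower_op d A (Suc j))"
      by (simp add: sum_subtractf algebra_simps)
    also have "\<dots> = gauss_op (c - 1) \<beta> (lower_op d A) (Suc i)"
      unfolding gauss_op_def sum.atLeast0_atMost_Suc_shift by (simp del: lower_op_simps(2))
    finally show ?thesis unfolding Suc .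
  qed (simp add: gauss_op_def)
qed

section \<open>Absolute convergence under the Gauss operator\<close>

text \<open>
  Absolute convergence at \<open>l = 0\<close>. Since the coefficients are unchanged when \<open>\<sigma>\<close>, \<open>a\<close> and \<open>b\<close> are
  shifted together, other values of \<open>l\<close> are covered by shifting these parameters.
\<close>

definition fac_summable :: "complex \<Rightarrow> (nat \<Rightarrow> complex) \<Rightarrow> bool" where
  "fac_summable \<sigma> A \<longleftrightarrow> summable (\<lambda>k. norm (A k * rGamma (\<sigma> + of_nat k)))"

abbreviation fac_sum :: "complex \<Rightarrow> (nat \<Rightarrow> complex) \<Rightarrow> complex" where
  "fac_sum \<sigma> A \<equiv> (\<Sum>k. A k * rGamma (\<sigma> + of_nat k))"

text \<open>
  The moduli of \<open>rGamma (z + m)\<close> and \<open>rGamma (Re z + m)\<close> are asymptotically equal; the factor two is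
  only a convenient margin. It reduces estimates of Gauss series to real positive parameters, where
  the series of moduli can be summed in closed form.
\<close>

lemma rGamma_compare_real_part:
  "eventually (\<lambda>m. norm (rGamma (z + of_nat m)) \<le> 2 * norm (rGamma (of_real (Re z) + of_nat m :: complex))
     \<and> norm (rGamma (of_real (Re z) + of_nat m :: complex)) \<le> 2 * norm (rGamma (z + of_nat m))) sequentially"
proof -
  let ?w = "\<lambda>m. fact m * real m powr (Re z - 1)"
  have *: "eventually (\<lambda>m. 3/4 < norm (rGamma (u + of_nat m)) * (fact m * real m powr (Re u - 1))
      \<and> norm (rGamma (u + of_nat m)) * (fact m * real m powr (Re u - 1)) < 3/2) sequentially" for u :: complex
  proof -
    let ?h = "\<lambda>m. norm (rGamma (u + of_nat m) * fact m * of_nat m powr (u - 1))"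
    have lim: "?h \<longlonglongrightarrow> 1"
      using tendsto_norm[OF rGamma_shift_asymp[of u]] by simp
    have "eventually (\<lambda>m. 3/4 < ?h m) sequentially" "eventually (\<lambda>m. ?h m < 3/2) sequentially"
      by (rule order_tendstoD[OF lim], simp)+
    then show ?thesis
      using eventually_gt_at_top[of 0]
    proof eventually_elim
      case (elim m)
      have "?h m = norm (rGamma (u + of_nat m)) * (fact m * real m powr (Re u - 1))"
        using elim(3) by (simp add: norm_mult norm_powr_real_powr)
      with elim(1,2) show ?case by (simp only:)
    qed
  qed
  note 1 = *[of z] and 2 = *[of "of_real (Re z)", unfolded Re_complex_of_real]
  from 1 2 eventually_gt_at_top[of 0] show ?thesis
  proof eventually_elim
    case (elim m)
    have w: "?w m > 0" using elim by simp
    have "norm (rGamma (z + of_nat m)) * ?w m \<le> (2 * norm (rGamma (of_real (Re z) + of_nat m :: complex))) * ?w m"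
      "norm (rGamma (of_real (Re z) + of_nat m :: complex)) * ?w m \<le> (2 * norm (rGamma (z + of_nat m))) * ?w m"
      using elim by linarith+
    then show ?case using w by (metis mult_le_cancel_right_pos)
  qed
qed

lemma pochhammer_compare_real_part:
  assumes "Re z > 0"
  obtains C where "C > 0" "\<And>n. norm (pochhammer z n) \<le> C * norm (pochhammer (of_real (Re z) :: complex) n)"
proof -
  let ?x = "of_real (Re z) :: complex"
  let ?P = "\<lambda>z n. pochhammer z n / (fact n * of_nat n powr (z - 1)) :: complex"
  have nz: "?x \<notin> \<int>\<^sub>\<le>\<^sub>0" by (rule Re_pos_not_nonpos_Ints) (use assms in simp)
  have lim: "(\<lambda>n. ?P z n / ?P ?x n) \<longlonglongrightarrow> rGamma z / rGamma ?x"
    by (intro tendsto_divide pochhammer_asymp) (use nz in \<open>simp add: rGamma_eq_zero_iff\<close>)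
  obtain C where C: "C > 0" "\<And>n. norm (?P z n / ?P ?x n) \<le> C"
    using convergent_imp_Bseq[OF convergentI[OF lim]] unfolding Bseq_def by blast
  have "norm (pochhammer z n) \<le> max C 1 * norm (pochhammer ?x n)" for n
  proof (cases "n = 0")
    case False
    have "pochhammer ?x n \<noteq> 0" using nz pochhammer_eq_0_imp_nonpos_Int by blast
    then have p: "norm (pochhammer ?x n) > 0" by simp
    have "norm (?P z n / ?P ?x n) = norm (pochhammer z n) / norm (pochhammer ?x n)"
      using False by (simp add: norm_divide norm_mult norm_powr_real_powr)
    then have "norm (pochhammer z n) \<le> C * norm (pochhammer ?x n)"
      using C(2)[of n] p by (simp add: pos_divide_le_eq)
    also have "\<dots> \<le> max C 1 * norm (pochhammer ?x n)" by (intro mult_right_mono) auto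
    finally show ?thesis .
  qed simp
  then show ?thesis using that[of "max C 1"] by simp
qed

lemma gauss_term_real_norm_sum:
  fixes x B A :: real
  assumes "x > 0" "B > 0" "A > 0"
  shows "(\<Sum>n. norm (gauss_term (of_real x) (of_real B) (of_real (x + B + A)) n))
      \<le> norm (Gamma (of_real A) * rGamma (of_real (A + x)) * rGamma (of_real (A + B)) :: complex)"
proof -
  define r where "r n = pochhammer x n * pochhammer B n / fact n * rGamma (x + B + A + real n)" for n
  have t: "gauss_term (of_real x) (of_real B) (of_real (x + B + A)) n = of_real (r n)" for n
  proof -
    have e: "of_real (x + B + A) + of_nat n = complex_of_real (x + B + A + real n)" by simp
    show ?thesis unfolding gauss_term_def e rGamma_complex_of_real r_def
      by (simp add: pochhammer_of_real)
  qed
  have r: "r n \<ge> 0" for n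
    unfolding r_def using assms
    by (intro mult_nonneg_nonneg divide_nonneg_nonneg pochhammer_nonneg)
       (auto simp: rGamma_inverse_Gamma intro!: less_imp_le Gamma_real_pos)
  let ?S = "Gamma (of_real A) * rGamma (of_real (A + x)) * rGamma (of_real (A + B)) :: complex"
  have "gauss_term (of_real x) (of_real B) (of_real x + of_real B + of_real A) sums
      (Gamma (of_real A) * rGamma (of_real A + of_real x) * rGamma (of_real A + of_real B))"
    by (rule gauss_summation) (use assms in simp)
  then have "(\<lambda>n. complex_of_real (r n)) sums ?S"
    by (simp add: t [symmetric, unfolded of_real_add] fun_eq_iff)
  then have "r sums Re ?S" using sums_Re by fastforce
  then have "(\<Sum>n. norm (gauss_term (of_real x) (of_real B) (of_real (x + B + A)) n)) = Re ?S"
    unfolding t using r by (simp add: sums_iff)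
  also have "\<dots> \<le> norm ?S" by (rule complex_Re_le_cmod)
  finally show ?thesis .
qed

text \<open>
  Compared with its real counterpart, each Gauss term grows by a bounded factor that does
  not depend on \<open>j\<close> or \<open>n\<close>. Gauss's theorem sums the real series, and the comparison is then undone. The
  hypothesis on \<open>\<beta>\<close> makes the real series one of positive terms; for \<open>Re \<beta> < 0\<close> the sum of moduli can be larger
  than the right-hand side by a power of \<open>j\<close>.
\<close>

lemma gauss_term_uniform_bound:
  assumes a: "Re a > 0" and \<beta>: "Re \<beta> > 0"
  obtains C where "eventually (\<lambda>j. (\<Sum>n. norm (gauss_term (\<alpha> + of_nat j) \<beta> (\<alpha> + \<beta> + a + of_nat j) n))
      \<le> C * norm (rGamma (\<alpha> + a + of_nat j))) sequentially"
proof -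
  define x B A where "x = Re \<alpha>" and "B = Re \<beta>" and "A = Re a"
  let ?g = "\<lambda>z. rGamma (of_real z :: complex)"
  have ev: "eventually (\<lambda>m. norm (rGamma (z + of_nat m)) \<le> 2 * norm (?g (Re z + real m))
     \<and> norm (?g (Re z + real m)) \<le> 2 * norm (rGamma (z + of_nat m))) sequentially" for z
    using rGamma_compare_real_part[of z] by simp
  obtain M1 where M1: "\<And>m. m \<ge> M1 \<Longrightarrow> norm (rGamma (\<alpha> + of_nat m)) \<le> 2 * norm (?g (x + real m))
     \<and> norm (?g (x + real m)) \<le> 2 * norm (rGamma (\<alpha> + of_nat m))"
    using ev[of \<alpha>] unfolding eventually_sequentially x_def by blast
  obtain M2 where M2: "\<And>m. m \<ge> M2 \<Longrightarrow> norm (rGamma (\<alpha> + \<beta> + a + of_nat m)) \<le> 2 * norm (?g (x + B + A + real m))"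
    using ev[of "\<alpha> + \<beta> + a"] unfolding eventually_sequentially x_def B_def A_def plus_complex.sel by blast
  obtain M3 where M3: "\<And>m. m \<ge> M3 \<Longrightarrow> norm (?g (x + A + real m)) \<le> 2 * norm (rGamma (\<alpha> + a + of_nat m))"
    using ev[of "\<alpha> + a"] unfolding eventually_sequentially x_def A_def plus_complex.sel by blast
  obtain M4 :: nat where M4: "\<bar>x\<bar> < real M4" using reals_Archimedean2 by blast
  obtain C\<beta> where C\<beta>: "C\<beta> > 0" "\<And>n. norm (pochhammer \<beta> n) \<le> C\<beta> * norm (pochhammer (of_real B :: complex) n)"
    using pochhammer_compare_real_part[OF \<beta>] unfolding B_def by blast
  \<comment> \<open>The two Gamma quotients compared below lose factors \<open>2 * 2\<close> (a Pochhammer symbol in \<open>\<alpha>\<close>) and \<open>2\<close>; the last factor \<open>2\<close> in \<open>K\<close> is lost on the way back.\<close>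
  define D where "D = 8 * C\<beta>"
  define K where "K = D * norm (Gamma (of_real A) :: complex) * norm (?g (A + B)) * 2"
  have main: "(\<Sum>n. norm (gauss_term (\<alpha> + of_nat j) \<beta> (\<alpha> + \<beta> + a + of_nat j) n)) \<le> K * norm (rGamma (\<alpha> + a + of_nat j))"
    if j: "j \<ge> max (max M1 M2) (max M3 M4)" for j
  proof -
    let ?X = "of_real (x + real j) :: complex"
    let ?u = "gauss_term (\<alpha> + of_nat j) \<beta> (\<alpha> + \<beta> + a + of_nat j)"
    let ?v = "gauss_term ?X (of_real B) (of_real (x + real j + B + A))"
    have pos: "x + real j > 0" using M4 j by linarith
    have poch: "norm (pochhammer (\<alpha> + of_nat j) n) \<le> 4 * norm (pochhammer ?X n)" for n
    proof -
      have e: "\<alpha> + of_nat j + of_nat n = \<alpha> + of_nat (j + n)" "?X + of_nat n = of_real (x + real (j + n))" by simp_all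
      have nz1: "\<alpha> + of_nat (j + n) \<notin> \<int>\<^sub>\<le>\<^sub>0" by (rule Re_pos_not_nonpos_Ints) (use pos in \<open>simp add: x_def\<close>)
      have nz2: "of_real (x + real (j + n)) \<notin> (\<int>\<^sub>\<le>\<^sub>0 :: complex set)" by (rule Re_pos_not_nonpos_Ints) (use pos in simp)
      define U V where "U = norm (rGamma (\<alpha> + of_nat (j + n)))" and "V = norm (?g (x + real (j + n)))"
      have UV: "U > 0" "V > 0" using nz1 nz2 by (simp_all add: U_def V_def rGamma_eq_zero_iff del: of_real_add of_nat_add)
      have "norm (pochhammer (\<alpha> + of_nat j) n) * U = norm (rGamma (\<alpha> + of_nat j))"
        using pochhammer_rGamma[of "\<alpha> + of_nat j" n] unfolding e U_def by (simp flip: norm_mult)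
      also have "\<dots> \<le> 2 * norm (?g (x + real j))" using M1[of j] j by simp
      also have "norm (?g (x + real j)) = norm (pochhammer ?X n) * V"
        using pochhammer_rGamma[of ?X n] unfolding e V_def by (simp flip: norm_mult)
      also have "2 * (norm (pochhammer ?X n) * V) \<le> 2 * (norm (pochhammer ?X n) * (2 * U))"
        unfolding U_def V_def using M1[of "j + n"] j by (intro mult_left_mono) auto
      finally show ?thesis using UV by simp
    qed
    have rg: "norm (rGamma (\<alpha> + \<beta> + a + of_nat j + of_nat n)) \<le> 2 * norm (rGamma (of_real (x + real j + B + A) + of_nat n :: complex))" for n
    proof -
      have e: "\<alpha> + \<beta> + a + of_nat j + of_nat n = \<alpha> + \<beta> + a + of_nat (j + n)"
        "of_real (x + real j + B + A) + of_nat n = complex_of_real (x + B + A + real (j + n))" by simp_all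
      show ?thesis unfolding e using M2[of "j + n"] j by simp
    qed
    have le: "norm (?u n) \<le> D * norm (?v n)" for n
    proof -
      have "norm (?u n) = norm (pochhammer (\<alpha> + of_nat j) n) * norm (pochhammer \<beta> n) / fact n
          * norm (rGamma (\<alpha> + \<beta> + a + of_nat j + of_nat n))"
        by (simp add: gauss_term_def norm_mult norm_divide)
      also have "\<dots> \<le> (4 * norm (pochhammer ?X n)) * (C\<beta> * norm (pochhammer (of_real B :: complex) n)) / fact n
          * (2 * norm (rGamma (of_real (x + real j + B + A) + of_nat n :: complex)))"
        using C\<beta> poch rg by (intro mult_mono divide_right_mono mult_nonneg_nonneg divide_nonneg_nonneg) auto
      also have "\<dots> = D * norm (?v n)"
        by (simp add: gauss_term_def norm_mult norm_divide D_def)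
      finally show ?thesis .
    qed
    have su: "summable (\<lambda>n. norm (?u n))" by (rule summable_norm_gauss_term) (use a in simp)
    have sv: "summable (\<lambda>n. norm (?v n))" by (rule summable_norm_gauss_term) (use a in \<open>simp add: A_def\<close>)
    have D: "D > 0" using C\<beta> by (simp add: D_def)
    have "(\<Sum>n. norm (?u n)) \<le> (\<Sum>n. D * norm (?v n))" by (intro suminf_le le su summable_mult sv)
    also have "\<dots> = D * (\<Sum>n. norm (?v n))" by (rule suminf_mult[OF sv])
    also have "\<dots> \<le> D * norm (Gamma (of_real A) * ?g (A + (x + real j)) * ?g (A + B))"
      by (intro mult_left_mono gauss_term_real_norm_sum) (use pos a \<beta> D in \<open>auto simp: A_def B_def\<close>)
    also have "\<dots> = D * norm (Gamma (of_real A) :: complex) * norm (?g (A + B)) * norm (?g (x + A + real j))"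
      by (simp add: norm_mult add_ac mult_ac)
    also have "\<dots> \<le> D * norm (Gamma (of_real A) :: complex) * norm (?g (A + B)) * (2 * norm (rGamma (\<alpha> + a + of_nat j)))"
      using M3[of j] j D by (intro mult_left_mono) auto
    also have "\<dots> = K * norm (rGamma (\<alpha> + a + of_nat j))" by (simp add: K_def)
    finally show ?thesis .
  qed
  show ?thesis by (rule that[of K]) (rule eventually_sequentiallyI[OF main])
qed

lemma gauss_op_fac_sums:
  assumes A: "fac_summable \<sigma> A" and a: "Re a > 0" and \<beta>: "Re \<beta> > 0"
  shows "fac_summable (\<sigma> + \<beta>) (gauss_op (\<sigma> - a) \<beta> A)"
    and "fac_sum (\<sigma> + \<beta>) (gauss_op (\<sigma> - a) \<beta> A) = Gamma a * rGamma (a + \<beta>) * fac_sum \<sigma> A"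
proof -
  define f where "f j n = A j * gauss_term (\<sigma> - a + of_nat j) \<beta> (\<sigma> + \<beta> + of_nat j) n" for j n
  have g: "\<sigma> + \<beta> + of_nat j = \<sigma> - a + of_nat j + \<beta> + a" for j by simp
  have sg: "summable (\<lambda>n. norm (gauss_term (\<sigma> - a + of_nat j) \<beta> (\<sigma> + \<beta> + of_nat j) n))" for j
    by (rule summable_norm_gauss_term) (use a in simp)
  have 1: "summable (\<lambda>n. norm (f j n))" for j
    unfolding f_def norm_mult by (intro summable_mult sg)
  have nsum: "(\<Sum>n. norm (f j n)) = norm (A j) * (\<Sum>n. norm (gauss_term (\<sigma> - a + of_nat j) \<beta> (\<sigma> + \<beta> + of_nat j) n))" for j
    unfolding f_def norm_mult by (rule suminf_mult[OF sg])
  obtain C where C: "eventually (\<lambda>j. (\<Sum>n. norm (gauss_term (\<sigma> - a + of_nat j) \<beta> (\<sigma> - a + \<beta> + a + of_nat j) n))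
      \<le> C * norm (rGamma (\<sigma> - a + a + of_nat j))) sequentially"
    using gauss_term_uniform_bound[OF a \<beta>, of "\<sigma> - a"] by blast
  have 2: "summable (\<lambda>j. \<Sum>n. norm (f j n))"
  proof (rule summable_comparison_test_ev)
    show "summable (\<lambda>j. C * norm (A j * rGamma (\<sigma> + of_nat j)))"
      using A unfolding fac_summable_def by (rule summable_mult)
    show "eventually (\<lambda>j. norm (\<Sum>n. norm (f j n)) \<le> C * norm (A j * rGamma (\<sigma> + of_nat j))) sequentially"
      using C
    proof eventually_elim
      case (elim j)
      have "norm (A j) * (\<Sum>n. norm (gauss_term (\<sigma> - a + of_nat j) \<beta> (\<sigma> + \<beta> + of_nat j) n)) \<le> norm (A j) * (C * norm (rGamma (\<sigma> + of_nat j)))"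
        using elim by (intro mult_left_mono) (auto simp: add_ac)
      moreover have "norm (\<Sum>n. norm (f j n)) = (\<Sum>n. norm (f j n))"
        using 1 by (simp add: suminf_nonneg)
      ultimately show ?case unfolding nsum by (simp add: norm_mult mult_ac)
    qed
  qed
  have row: "(\<Sum>n. f j n) = Gamma a * rGamma (a + \<beta>) * (A j * rGamma (\<sigma> + of_nat j))" for j
  proof -
    have "f j sums (A j * (Gamma a * rGamma (a + (\<sigma> - a + of_nat j)) * rGamma (a + \<beta>)))"
      unfolding f_def g by (intro sums_mult gauss_summation a)
    from sums_unique[OF this] show ?thesis by (simp add: mult_ac add_ac)
  qed
  have diag: "(\<Sum>j=0..k. f j (k - j)) = gauss_op (\<sigma> - a) \<beta> A k * rGamma (\<sigma> + \<beta> + of_nat k)" for k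
    unfolding gauss_op_def sum_distrib_right
  proof (intro sum.cong refl)
    fix j assume "j \<in> {0..k}"
    then have e: "\<sigma> + \<beta> + of_nat j + of_nat (k - j) = \<sigma> + \<beta> + of_nat k" by (simp add: of_nat_diff)
    show "f j (k - j) = gauss_kernel (\<sigma> - a) \<beta> j (k - j) * A j * rGamma (\<sigma> + \<beta> + of_nat k)"
      unfolding f_def gauss_term_def gauss_kernel_def e by simp
  qed
  note D = iterated_series_diagonal[of f, OF 1 2, unfolded diag row]
  show "fac_summable (\<sigma> + \<beta>) (gauss_op (\<sigma> - a) \<beta> A)" using D(1) by (simp add: fac_summable_def)
  have "summable (\<lambda>k. A k * rGamma (\<sigma> + of_nat k))"
    using A unfolding fac_summable_def by (rule summable_norm_cancel)
  from suminf_mult[OF this] D(2)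
  show "fac_sum (\<sigma> + \<beta>) (gauss_op (\<sigma> - a) \<beta> A) = Gamma a * rGamma (a + \<beta>) * fac_sum \<sigma> A"
    by (simp add: sums_iff)
qed

section \<open>Smooth coefficient sequences and arbitrary numerator excess\<close>

text \<open>
  A nonzero limit would make the terms comparable to those of the harmonic series.
\<close>

lemma limit_zero_of_summable:
  fixes e :: "nat \<Rightarrow> complex"
  assumes e: "summable (\<lambda>k. norm (e k))" and lim: "(\<lambda>k. (s + of_nat k) * e k) \<longlonglongrightarrow> L"
  shows "L = 0"
proof (rule ccontr)
  assume L: "L \<noteq> 0"
  have "e \<longlonglongrightarrow> 0" using summable_LIMSEQ_zero[OF e] by (simp add: tendsto_norm_zero_iff)
  then have "(\<lambda>k. (s + of_nat k) * e k - s * e k) \<longlonglongrightarrow> L - s * 0"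
    by (intro tendsto_diff lim tendsto_mult tendsto_const)
  then have "(\<lambda>k. norm (of_nat k * e k)) \<longlonglongrightarrow> norm L"
    by (simp add: algebra_simps tendsto_norm)
  then have "eventually (\<lambda>k. norm (of_nat k * e k) > norm L / 2) sequentially"
    by (rule order_tendstoD) (use L in simp)
  then have "eventually (\<lambda>k. norm (inverse (of_nat k) :: real) \<le> 2 / norm L * norm (e k)) sequentially"
    using eventually_gt_at_top[of 0]
  proof eventually_elim
    case (elim k)
    have "norm L / 2 < real k * norm (e k)" using elim(1) by (simp add: norm_mult)
    then show ?case using L elim(2) by (simp add: field_simps)
  qed
  then have "summable (\<lambda>k. inverse (of_nat k) :: real)"
    by (rule summable_comparison_test_ev) (intro summable_mult e)
  then show False using not_summable_harmonic by blast
qed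

text \<open>
  Abel summation: the partial sums of the two series differ by the boundary term
  \<open>(\<sigma> - 1 + n) A\<^sub>n / \<Gamma>(\<sigma> + n)\<close>. It converges because both series do, and then its limit is zero by
  \<open>limit_zero_of_summable\<close>.
\<close>

lemma fac_sum_lower_op:
  assumes A: "fac_summable \<sigma> A" and B: "fac_summable (\<sigma> - 1) (lower_op d A)"
  shows "fac_sum (\<sigma> - 1) (lower_op d A) = (\<sigma> - 1 - d) * fac_sum \<sigma> A"
proof -
  let ?e = "\<lambda>k. A k * rGamma (\<sigma> + of_nat k)" and ?B = "lower_op d A"
  have r: "rGamma (\<sigma> - 1 + of_nat k) = (\<sigma> - 1 + of_nat k) * rGamma (\<sigma> + of_nat k)" for k
    using rGamma_plus1[of "\<sigma> - 1 + of_nat k"] by simp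
  have partial: "(\<Sum>k<Suc n. ?B k * rGamma (\<sigma> - 1 + of_nat k)) =
      (\<sigma> - 1 - d) * (\<Sum>k<n. ?e k) + (\<sigma> - 1 + of_nat n) * ?e n" for n
  proof (induction n)
    case 0
    then show ?case using r[of 0] by simp
  next
    case (Suc n)
    have s: "rGamma (\<sigma> - 1 + of_nat (Suc n)) = rGamma (\<sigma> + of_nat n)" by simp
    have "(\<Sum>k<Suc (Suc n). ?B k * rGamma (\<sigma> - 1 + of_nat k)) =
        (\<sigma> - 1 - d) * (\<Sum>k<n. ?e k) + (\<sigma> - 1 + of_nat n) * ?e n
        + (A (Suc n) - (d + of_nat n) * A n) * rGamma (\<sigma> + of_nat n)"
      unfolding sum.lessThan_Suc[of _ "Suc n"] Suc.IH s by simp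
    also have "\<dots> = (\<sigma> - 1 - d) * (\<Sum>k<Suc n. ?e k) + A (Suc n) * rGamma (\<sigma> - 1 + of_nat (Suc n))"
      unfolding s by (simp add: algebra_simps)
    also have "A (Suc n) * rGamma (\<sigma> - 1 + of_nat (Suc n)) = (\<sigma> - 1 + of_nat (Suc n)) * ?e (Suc n)"
      unfolding r by (simp only: mult_ac)
    finally show ?case .
  qed
  have e: "summable ?e" using A unfolding fac_summable_def by (rule summable_norm_cancel)
  have b: "summable (\<lambda>k. ?B k * rGamma (\<sigma> - 1 + of_nat k))"
    using B unfolding fac_summable_def by (rule summable_norm_cancel)
  let ?L = "fac_sum (\<sigma> - 1) ?B - (\<sigma> - 1 - d) * fac_sum \<sigma> A"
  have "(\<lambda>n. (\<Sum>k<Suc n. ?B k * rGamma (\<sigma> - 1 + of_nat k)) - (\<sigma> - 1 - d) * (\<Sum>k<n. ?e k)) \<longlonglongrightarrow> ?L"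
    by (intro tendsto_diff tendsto_mult tendsto_const summable_LIMSEQ e)
       (rule LIMSEQ_Suc[OF summable_LIMSEQ[OF b]])
  then have "(\<lambda>n. (\<sigma> - 1 + of_nat n) * ?e n) \<longlonglongrightarrow> ?L"
    unfolding partial by simp
  then have "?L = 0"
    using A unfolding fac_summable_def by (rule limit_zero_of_summable[rotated])
  then show ?thesis by simp
qed

text \<open>
  Applying \<open>lower_op\<close> to \<open>A\<close> costs a factor \<open>k\<close> in the size of a general sequence. Smoothness to order \<open>r\<close> says that
  up to \<open>r\<close> applications, with arbitrary parameters, cause no loss of summability, as for
  coefficients whose quotients by \<open>\<Gamma>(\<sigma> + k)\<close> behave like a power of \<open>k\<close> together with their successive differences.
\<close>

primrec fac_smooth :: "nat \<Rightarrow> complex \<Rightarrow> (nat \<Rightarrow> complex) \<Rightarrow> bool" where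
  "fac_smooth 0 \<sigma> A \<longleftrightarrow> fac_summable \<sigma> A"
| "fac_smooth (Suc r) \<sigma> A \<longleftrightarrow> (\<forall>d. fac_smooth r (\<sigma> - 1) (lower_op d A))"

lemma fac_smooth_lower_op:
  assumes "\<And>r. fac_smooth r \<sigma> A"
  shows "fac_smooth r (\<sigma> - 1) (lower_op d A)"
  using assms[of "Suc r"] by simp

lemma fac_smooth_finite_support:
  "(\<And>k. k \<ge> n \<Longrightarrow> A k = 0) \<Longrightarrow> fac_smooth r \<sigma> A"
proof (induction r arbitrary: n \<sigma> A)
  case 0
  then show ?case unfolding fac_smooth.simps fac_summable_def
    by (intro summable_finite[of "{..<n}"]) auto
next
  case (Suc r)
  have "fac_smooth r (\<sigma> - 1) (lower_op d A)" for d
  proof (rule Suc.IH[of "Suc n"])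
    fix k assume "Suc n \<le> k"
    then show "lower_op d A k = 0" using Suc.prems by (cases k) auto
  qed
  then show ?case by simp
qed

lemma fac_smooth_gauss_op_pos:
  assumes a: "Re a > 0" and \<beta>: "Re \<beta> > 0"
  shows "fac_smooth r \<sigma> A \<Longrightarrow> fac_smooth r (\<sigma> + \<beta>) (gauss_op (\<sigma> - a) \<beta> A)"
proof (induction r arbitrary: \<sigma> A)
  case 0
  then show ?case using gauss_op_fac_sums(1)[OF _ a \<beta>] by simp
next
  case (Suc r)
  have "fac_smooth r (\<sigma> + \<beta> - 1) (lower_op d (gauss_op (\<sigma> - a) \<beta> A))" for d
  proof -
    have "fac_smooth r (\<sigma> - 1 + \<beta>) (gauss_op (\<sigma> - 1 - a) \<beta> (lower_op (d - \<beta>) A))"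
      by (rule Suc.IH) (use Suc.prems in simp)
    moreover have "gauss_op (\<sigma> - 1 - a) \<beta> (lower_op (d - \<beta>) A) = lower_op d (gauss_op (\<sigma> - a) \<beta> A)"
      using lower_gauss_op_commute[of "d - \<beta>" \<beta> "\<sigma> - a" A] by (simp add: algebra_simps)
    ultimately show ?thesis by (simp add: algebra_simps)
  qed
  then show ?case by simp
qed

text \<open>
  For \<open>Re \<beta> > 0\<close> smoothness is inherited because \<open>lower_op\<close> commutes with \<open>gauss_op\<close>. Otherwise \<open>\<beta>\<close> is
  raised by an integer, and \<open>gauss_op_lower\<close> leads back at the price of one order
  of smoothness per step; hence smoothness of every order is assumed.
\<close>

lemma gauss_op_smooth:
  assumes a: "Re a > 0" and A: "\<And>r. fac_smooth r \<sigma> A"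
  shows "fac_smooth r (\<sigma> + \<beta>) (gauss_op (\<sigma> - a) \<beta> A)"
    and "fac_sum (\<sigma> + \<beta>) (gauss_op (\<sigma> - a) \<beta> A) = Gamma a * rGamma (a + \<beta>) * fac_sum \<sigma> A"
proof -
  have A0: "fac_summable \<sigma> A" using A[of 0] by simp
  have *: "(\<forall>r. fac_smooth r (\<sigma> + \<beta>) (gauss_op (\<sigma> - a) \<beta> A)) \<and>
      fac_sum (\<sigma> + \<beta>) (gauss_op (\<sigma> - a) \<beta> A) = Gamma a * rGamma (a + \<beta>) * fac_sum \<sigma> A"
    if "Re \<beta> + real N > 0" for N \<beta>
    using that
  proof (induction N arbitrary: \<beta>)
    case 0
    then have \<beta>: "Re \<beta> > 0" by simp
    show ?case using fac_smooth_gauss_op_pos[OF a \<beta> A] gauss_op_fac_sums(2)[OF A0 a \<beta>] by blast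
  next
    case (Suc N)
    \<comment> \<open>Smoothness of \<open>?T\<close>, not merely its summability, controls \<open>lower_op (\<sigma> - a) ?T\<close>.\<close>
    let ?T = "gauss_op (\<sigma> - a) (\<beta> + 1) A"
    have low: "gauss_op (\<sigma> - a) \<beta> A = lower_op (\<sigma> - a) ?T" by (rule gauss_op_lower)
    have IH: "fac_smooth r (\<sigma> + (\<beta> + 1)) ?T" "fac_sum (\<sigma> + (\<beta> + 1)) ?T = Gamma a * rGamma (a + (\<beta> + 1)) * fac_sum \<sigma> A" for r
      using Suc.IH[of "\<beta> + 1"] Suc.prems by auto
    have s: "\<sigma> + (\<beta> + 1) - 1 = \<sigma> + \<beta>" by simp
    have sm: "fac_smooth r (\<sigma> + \<beta>) (gauss_op (\<sigma> - a) \<beta> A)" for r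
      using fac_smooth_lower_op[OF IH(1), of r "\<sigma> - a"] unfolding low s .
    have "fac_summable (\<sigma> + (\<beta> + 1)) ?T" using IH(1)[of 0] by simp
    moreover have "fac_summable (\<sigma> + (\<beta> + 1) - 1) (lower_op (\<sigma> - a) ?T)"
      using sm[of 0] unfolding low s by simp
    ultimately have "fac_sum (\<sigma> + (\<beta> + 1) - 1) (lower_op (\<sigma> - a) ?T) = (\<sigma> + (\<beta> + 1) - 1 - (\<sigma> - a)) * fac_sum (\<sigma> + (\<beta> + 1)) ?T"
      by (rule fac_sum_lower_op)
    then have "fac_sum (\<sigma> + \<beta>) (gauss_op (\<sigma> - a) \<beta> A) = (a + \<beta>) * (Gamma a * rGamma (a + \<beta> + 1) * fac_sum \<sigma> A)"
      unfolding low s IH(2) by (simp add: add_ac)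
    also have "\<dots> = Gamma a * rGamma (a + \<beta>) * fac_sum \<sigma> A"
      unfolding rGamma_plus1[of "a + \<beta>", symmetric] by (simp only: mult_ac)
    finally show ?case using sm by blast
  qed
  obtain N :: nat where "norm \<beta> < real N" using reals_Archimedean2 by blast
  then have "Re \<beta> + real N > 0" using abs_Re_le_cmod[of \<beta>] by simp
  from *[OF this] show "fac_smooth r (\<sigma> + \<beta>) (gauss_op (\<sigma> - a) \<beta> A)"
    and "fac_sum (\<sigma> + \<beta>) (gauss_op (\<sigma> - a) \<beta> A) = Gamma a * rGamma (a + \<beta>) * fac_sum \<sigma> A" by auto
qed

section \<open>The coefficients of the hypergeometric term\<close>

lemma A_coeff_Suc:
  assumes "p \<ge> 1"
  shows "A_coeff (Suc p) a b = gauss_op ((\<Sum>i=2..Suc p. b i) - (\<Sum>i=3..Suc p + 1. a i)) (b 1 - a 3)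
           (A_coeff p (\<lambda>i. a (Suc i)) (\<lambda>i. b (Suc i)))"
proof -
  obtain q where "p = Suc q" using assms by (cases p) auto
  then show ?thesis by (simp add: fun_eq_iff gauss_op_def gauss_kernel_def Let_def)
qed

text \<open>
  The parameter \<open>\<sigma>\<close> of the factorial series with coefficients \<open>A_coeff p a b\<close>.
\<close>

definition coeff_excess :: "nat \<Rightarrow> (nat \<Rightarrow> complex) \<Rightarrow> (nat \<Rightarrow> complex) \<Rightarrow> complex" where
  "coeff_excess p a b = (\<Sum>i=1..p. b i) - (\<Sum>i=3..p+1. a i)"

lemma sum_split_first: "m \<le> Suc n \<Longrightarrow> (\<Sum>i=m..Suc n. f i) = f m + (\<Sum>i=m..n. f (Suc i))" for f :: "nat \<Rightarrow> 'a :: comm_monoid_add"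
  by (metis sum.atLeast_Suc_atMost sum.shift_bounds_cl_Suc_ivl)

lemma prod_split_first: "m \<le> Suc n \<Longrightarrow> (\<Prod>i=m..Suc n. f i) = f m * (\<Prod>i=m..n. f (Suc i))" for f :: "nat \<Rightarrow> 'a :: comm_monoid_mult"
  by (metis prod.atLeast_Suc_atMost prod.shift_bounds_cl_Suc_ivl)

lemma A_coeff_0: "p \<ge> 1 \<Longrightarrow> A_coeff p a b 0 = 1"
proof (induction p arbitrary: a b rule: nat_induct_at_least)
  case (Suc p)
  then show ?case by (simp add: A_coeff_Suc gauss_op_def del: A_coeff.simps)
qed simp

text \<open>
  Only differences between upper and lower parameters enter the coefficients, so the same coefficients serve every \<open>l\<close>.
\<close>

lemma A_coeff_shift:
  "p \<ge> 1 \<Longrightarrow> A_coeff p (\<lambda>i. a i + z) (\<lambda>i. b i + z) = A_coeff p a b"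
proof (induction p arbitrary: a b rule: nat_induct_at_least)
  case base
  then show ?case by (simp add: fun_eq_iff)
next
  case (Suc p)
  have "(\<Sum>i=2..Suc p. b i + z) - (\<Sum>i=3..Suc p + 1. a i + z) = (\<Sum>i=2..Suc p. b i) - (\<Sum>i=3..Suc p + 1. a i)"
    by (simp add: sum.distrib)
  then show ?case using Suc.IH[of "\<lambda>i. a (Suc i)" "\<lambda>i. b (Suc i)"]
    by (simp add: A_coeff_Suc[OF Suc.hyps] del: A_coeff.simps)
qed

text \<open>
  Induction on \<open>p\<close>: the recursion for the coefficients is \<open>gauss_op\<close> with \<open>a = a\<^sub>3\<close> and \<open>b = b\<^sub>1\<close>, applied to the series for
  the parameters that remain.
\<close>

theorem A_coeff_factorial_series:
  assumes "p \<ge> 1" and "\<And>j. j \<in> {3..p+1} \<Longrightarrow> Re (a j) > 0"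
  shows "fac_smooth r (coeff_excess p a b) (A_coeff p a b)"
    and "fac_sum (coeff_excess p a b) (A_coeff p a b) = (\<Prod>j=3..p+1. Gamma (a j)) * (\<Prod>j=1..p. rGamma (b j))"
proof -
  have "(\<forall>r. fac_smooth r (coeff_excess p a b) (A_coeff p a b)) \<and>
      fac_sum (coeff_excess p a b) (A_coeff p a b) = (\<Prod>j=3..p+1. Gamma (a j)) * (\<Prod>j=1..p. rGamma (b j))"
    using assms
  proof (induction p arbitrary: a b rule: nat_induct_at_least)
    case base
    have "(\<Sum>k. (if k = (0::nat) then 1 else 0) * rGamma (b 1 + of_nat k)) = (\<Sum>k\<in>{0}. (if k = (0::nat) then 1 else 0) * rGamma (b 1 + of_nat k))"
      by (rule suminf_finite) auto
    moreover have "fac_smooth r (b 1) (\<lambda>k. if k = 0 then 1 else 0)" for r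
      by (rule fac_smooth_finite_support[of 1]) auto
    ultimately show ?case by (simp add: coeff_excess_def fun_eq_iff cong: if_cong)
  next
    case (Suc p)
    let ?a = "\<lambda>i. a (Suc i)" and ?b = "\<lambda>i. b (Suc i)"
    let ?\<sigma> = "coeff_excess p ?a ?b"
    have pos: "Re (a 3) > 0" using Suc.prems[of 3] Suc.hyps by simp
    have IH: "\<And>r. fac_smooth r ?\<sigma> (A_coeff p ?a ?b)"
      "fac_sum ?\<sigma> (A_coeff p ?a ?b) = (\<Prod>j=3..p+1. Gamma (?a j)) * (\<Prod>j=1..p. rGamma (?b j))"
      using Suc.IH[of ?a ?b] Suc.prems by auto
    have sa: "(\<Sum>i=3..Suc p + 1. a i) = a 3 + (\<Sum>i=3..p+1. ?a i)"
      using sum_split_first[of 3 "p + 1" a] Suc.hyps by simp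
    have sb: "(\<Sum>i=1..Suc p. b i) = b 1 + (\<Sum>i=1..p. ?b i)"
      by (rule sum_split_first) simp
    have sb2: "(\<Sum>i=2..Suc p. b i) = (\<Sum>i=1..p. ?b i)"
      using sum.shift_bounds_cl_Suc_ivl[of b 1 p] by (simp add: numeral_2_eq_2)
    have c: "(\<Sum>i=2..Suc p. b i) - (\<Sum>i=3..Suc p + 1. a i) = ?\<sigma> - a 3"
      unfolding coeff_excess_def sa sb2 by simp
    have e: "coeff_excess (Suc p) a b = ?\<sigma> + (b 1 - a 3)"
      unfolding coeff_excess_def sa sb by simp
    have pa: "(\<Prod>j=3..Suc p + 1. Gamma (a j)) = Gamma (a 3) * (\<Prod>j=3..p+1. Gamma (?a j))"
      using prod_split_first[of 3 "p + 1" "\<lambda>j. Gamma (a j)"] Suc.hyps by simp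
    have pb: "(\<Prod>j=1..Suc p. rGamma (b j)) = rGamma (b 1) * (\<Prod>j=1..p. rGamma (?b j))"
      using prod_split_first[of 1 p "\<lambda>j. rGamma (b j)"] by simp
    have A: "A_coeff (Suc p) a b = gauss_op (?\<sigma> - a 3) (b 1 - a 3) (A_coeff p ?a ?b)"
      unfolding A_coeff_Suc[OF Suc.hyps] c ..
    have "fac_smooth r (coeff_excess (Suc p) a b) (A_coeff (Suc p) a b)" for r
      unfolding A e by (rule gauss_op_smooth(1)[OF pos IH(1)])
    moreover have "fac_sum (coeff_excess (Suc p) a b) (A_coeff (Suc p) a b) =
        (\<Prod>j=3..Suc p + 1. Gamma (a j)) * (\<Prod>j=1..Suc p. rGamma (b j))"
      unfolding A e pa pb gauss_op_smooth(2)[OF pos IH(1)] IH(2) by simp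
    ultimately show ?case by blast
  qed
  then show "fac_smooth r (coeff_excess p a b) (A_coeff p a b)"
    and "fac_sum (coeff_excess p a b) (A_coeff p a b) = (\<Prod>j=3..p+1. Gamma (a j)) * (\<Prod>j=1..p. rGamma (b j))"
    by auto
qed

section \<open>Orders of decay in negative powers\<close>

text \<open>
  A discrete substitute for bounding \<open>m\<^sup>-\<^sup>q\<^sup>-\<^sup>2\<close> by the derivative of \<open>m\<^sup>-\<^sup>q\<^sup>-\<^sup>1\<close>.
\<close>

lemma inverse_power_telescope_bound:
  fixes m q :: nat
  assumes "m > 0"
  shows "inverse (real m ^ (q + 2)) \<le> 2 ^ (q + 1) * (inverse (real m ^ (q + 1)) - inverse (real (Suc m) ^ (q + 1)))"
proof -
  define x where "x = real m"
  have x: "x \<ge> 1" "real (Suc m) = x + 1" using assms by (auto simp: x_def)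
  have "x ^ q * (x + 1) \<le> (x + 1) ^ q * (x + 1)"
    using x by (intro mult_right_mono power_mono) auto
  then have num: "x ^ q \<le> (x + 1) ^ (q + 1) - x ^ (q + 1)"
    by (simp add: algebra_simps)
  have "inverse (2 ^ (q + 1)) * inverse (x ^ (q + 2)) = x ^ q / (x ^ (q + 1) * (2 * x) ^ (q + 1))"
    using x by (simp add: power_mult_distrib divide_simps)
  also have "\<dots> \<le> x ^ q / (x ^ (q + 1) * (x + 1) ^ (q + 1))"
    using x by (intro divide_left_mono mult_left_mono power_mono mult_pos_pos) auto
  also have "\<dots> \<le> ((x + 1) ^ (q + 1) - x ^ (q + 1)) / (x ^ (q + 1) * (x + 1) ^ (q + 1))"
    using x by (intro divide_right_mono num) auto
  also have "\<dots> = inverse (x ^ (q + 1)) - inverse ((x + 1) ^ (q + 1))"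
  proof -
    have "x ^ (q + 1) \<noteq> 0" "(x + 1) ^ (q + 1) \<noteq> 0" using x by auto
    then show ?thesis by (metis diff_divide_distrib inverse_eq_divide nonzero_divide_mult_cancel_left nonzero_divide_mult_cancel_right)
  qed
  finally have "2 ^ (q + 1) * (inverse (2 ^ (q + 1)) * inverse (x ^ (q + 2))) \<le>
      2 ^ (q + 1) * (inverse (x ^ (q + 1)) - inverse ((x + 1) ^ (q + 1)))"
    by (intro mult_left_mono) auto
  moreover have "2 ^ (q + 1) * (inverse (2 ^ (q + 1)) * y) = y" for y :: real by simp
  ultimately show ?thesis
    unfolding x(2) x_def [symmetric] by (simp only:)
qed

text \<open>
  The value \<open>x m\<close> is minus the sum of all later differences, and summation raises the order by one.
\<close>

lemma bigo_of_differences: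
  fixes x :: "nat \<Rightarrow> complex"
  assumes lim: "x \<longlonglongrightarrow> 0"
    and diff: "(\<lambda>m. x (Suc m) - x m) \<in> O(\<lambda>m. inverse (of_nat m ^ (q + 2)))"
  shows "x \<in> O(\<lambda>m. inverse (of_nat m ^ (q + 1)))"
proof -
  obtain c where c: "c > 0" "eventually (\<lambda>m. norm (x (Suc m) - x m) \<le> c * norm (inverse (of_nat m ^ (q + 2)) :: complex)) sequentially"
    using landau_o.bigE[OF diff] by blast
  then obtain M where M: "\<And>m. m \<ge> M \<Longrightarrow> norm (x (Suc m) - x m) \<le> c * inverse (real m ^ (q + 2))"
    unfolding eventually_at_top_linorder norm_inverse norm_power norm_of_nat by blast
  define K where "K = c * 2 ^ (q + 1)"
  have tele_step: "norm (x (Suc m) - x m) \<le> K * (inverse (real m ^ (q + 1)) - inverse (real (Suc m) ^ (q + 1)))" if "m \<ge> Suc M" for m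
  proof -
    have "norm (x (Suc m) - x m) \<le> c * inverse (real m ^ (q + 2))" using M[of m] that by simp
    also have "\<dots> \<le> c * (2 ^ (q + 1) * (inverse (real m ^ (q + 1)) - inverse (real (Suc m) ^ (q + 1))))"
      using c that by (intro mult_left_mono inverse_power_telescope_bound) auto
    finally show ?thesis by (simp add: K_def mult_ac)
  qed
  have tele: "norm (x n - x m) \<le> K * (inverse (real m ^ (q + 1)) - inverse (real n ^ (q + 1)))"
    if "m \<ge> Suc M" "n \<ge> m" for m n
    using that(2)
  proof (induction n rule: dec_induct)
    case (step n)
    have "norm (x (Suc n) - x m) \<le> norm (x (Suc n) - x n) + norm (x n - x m)"
      using norm_triangle_ineq[of "x (Suc n) - x n" "x n - x m"] by simp
    then show ?case
      using step.IH tele_step[of n] step.hyps that(1) by (simp add: algebra_simps)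
  qed simp
  have "norm (x m) \<le> K * inverse (real m ^ (q + 1))" if "m \<ge> Suc M" for m
  proof -
    have "(\<lambda>n. norm (x n - x m)) \<longlonglongrightarrow> norm (0 - x m)" by (intro tendsto_intros lim)
    moreover have "eventually (\<lambda>n. norm (x n - x m) \<le> K * inverse (real m ^ (q + 1))) sequentially"
      using eventually_ge_at_top[of m]
    proof eventually_elim
      case (elim n)
      have "K \<ge> 0" using c by (simp add: K_def)
      then have "K * (inverse (real m ^ (q + 1)) - inverse (real n ^ (q + 1))) \<le> K * inverse (real m ^ (q + 1))"
        by (intro mult_left_mono) auto
      then show ?case using tele[OF that elim] by linarith
    qed
    ultimately have "norm (0 - x m) \<le> K * inverse (real m ^ (q + 1))"
      by (rule tendsto_upperbound) simp
    then show ?thesis by simp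
  qed
  then have bound: "\<forall>\<^sub>F m in sequentially. norm (x m) \<le> K * norm (inverse (of_nat m ^ (q + 1)) :: complex)"
    unfolding norm_inverse norm_power norm_of_nat by (rule eventually_sequentiallyI)
  have "K > 0" using c by (simp add: K_def)
  from landau_o.bigI[OF this bound] show ?thesis .
qed

abbreviation neg_pow :: "nat \<Rightarrow> nat \<Rightarrow> complex" where
  "neg_pow k \<equiv> (\<lambda>m. inverse (of_nat m ^ k))"

lemma bigo_neg_pow_mult:
  assumes "f \<in> O(neg_pow j)" "g \<in> O(neg_pow k)"
  shows "(\<lambda>m. f m * g m) \<in> O(neg_pow (j + k))"
  using landau_o.big.mult[OF assms] by (simp add: power_add)

lemma neg_pow_mono:
  assumes "j \<le> k"
  shows "neg_pow k \<in> O(neg_pow j)"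
proof (rule bigoI[of _ 1], rule eventually_sequentiallyI[of 1])
  fix m :: nat assume m: "1 \<le> m"
  then have "real m ^ j \<le> real m ^ k" using assms by (intro power_increasing) auto
  moreover have "0 < real m ^ j" using m by simp
  ultimately show "norm (neg_pow k m) \<le> 1 * norm (neg_pow j m)"
    unfolding norm_inverse norm_power norm_of_nat mult_1_left by (rule le_imp_inverse_le)
qed

lemma inverse_shift_bigo: "(\<lambda>m. inverse (of_nat m + z)) \<in> O(neg_pow 1)"
proof (rule bigoI_tendsto)
  have "(\<lambda>m. inverse (1 + z / of_nat m)) \<longlonglongrightarrow> inverse 1"
    by (intro tendsto_inverse tendsto_one_plus_over_of_nat) simp
  moreover have "eventually (\<lambda>m. inverse (1 + z / of_nat m) = inverse (of_nat m + z) / inverse (of_nat m ^ 1)) sequentially"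
    using eventually_gt_at_top[of 0]
  proof eventually_elim
    case (elim m)
    have "1 + z / of_nat m = (of_nat m + z) / of_nat m" using elim by (simp add: add_divide_distrib)
    then show ?case by (simp add: field_simps)
  qed
  ultimately show "(\<lambda>m. inverse (of_nat m + z) / inverse (of_nat m ^ 1)) \<longlonglongrightarrow> inverse 1"
    by (rule Lim_transform_eventually)
  show "eventually (\<lambda>m. inverse (of_nat m ^ 1) \<noteq> (0 :: complex)) sequentially"
    using eventually_gt_at_top[of 0] by eventually_elim simp
qed

lemma inverse_shift3_bigo:
  "(\<lambda>m. inverse ((of_nat m + z1) * (of_nat m + z2) * (of_nat m + z3))) \<in> O(neg_pow 3)"
  using bigo_neg_pow_mult[OF bigo_neg_pow_mult[OF inverse_shift_bigo[of z1] inverse_shift_bigo[of z2]] inverse_shift_bigo[of z3]]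
  by (simp add: numeral_3_eq_3)

lemma inverse_shift4_bigo:
  "(\<lambda>m. inverse ((of_nat m + z1) * (of_nat m + z2) * (of_nat m + z3) * (of_nat m + z4))) \<in> O(neg_pow 4)"
  using bigo_neg_pow_mult[OF inverse_shift3_bigo[of z1 z2 z3] inverse_shift_bigo[of z4]]
  by (simp add: numeral_eq_Suc)

lemma bigo_cmult: "f \<in> O(g) \<Longrightarrow> (\<lambda>m. c * f m) \<in> O(g)" for c :: complex
  by (cases "c = 0") simp_all

lemma inverse_shift_tendsto: "(\<lambda>m. inverse (of_nat m + z)) \<longlonglongrightarrow> (0 :: complex)"
proof -
  have "filterlim (\<lambda>m. of_nat m + z) at_infinity sequentially"
    unfolding add.commute[of _ z] by (intro tendsto_add_filterlim_at_infinity[OF tendsto_const] tendsto_of_nat)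
  then show ?thesis by (rule filterlim_compose[OF tendsto_inverse_0])
qed

section \<open>Zero-balanced terms with two numerator parameters\<close>

text \<open>
  The summand \<open>u\<^sub>k(l)\<close> of the zero-balanced series whose lower parameter has been raised by \<open>k\<close>.
\<close>

definition base_term :: "complex \<Rightarrow> complex \<Rightarrow> nat \<Rightarrow> nat \<Rightarrow> complex" where
  "base_term x y k l = Gamma (x + of_nat l) * Gamma (y + of_nat l) * rGamma (x + y + of_nat k + of_nat l) * rGamma (1 + of_nat l)"

lemma base_term_commute: "base_term x y = base_term y x"
  by (simp add: base_term_def fun_eq_iff ac_simps)

lemma base_term_lower: "base_term x y k l = (x + y + of_nat k + of_nat l) * base_term x y (Suc k) l"
  using rGamma_plus1[of "x + y + of_nat k + of_nat l"] by (simp add: base_term_def add_ac mult_ac)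

lemma not_nonpos_shift:
  fixes x :: complex
  assumes "x \<notin> \<int>\<^sub>\<le>\<^sub>0"
  shows "x + of_nat l \<notin> \<int>\<^sub>\<le>\<^sub>0"
proof
  assume "x + of_nat l \<in> \<int>\<^sub>\<le>\<^sub>0"
  then obtain n where n: "x + of_nat l = of_int n" "n \<le> 0" by (auto elim: nonpos_Ints_cases)
  then have "x = of_int (n - int l)" by (simp add: eq_diff_eq)
  moreover have "n - int l \<le> 0" using n by simp
  ultimately show False using assms by (metis nonpos_Ints_of_int)
qed

lemma base_term_raise:
  assumes "x \<notin> \<int>\<^sub>\<le>\<^sub>0" "y \<notin> \<int>\<^sub>\<le>\<^sub>0"
  shows "of_nat (Suc l) * base_term x y k (Suc l) = (x + of_nat l) * (y + of_nat l) * base_term x y (Suc k) l"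
proof -
  have g: "Gamma (x + of_nat (Suc l)) = (x + of_nat l) * Gamma (x + of_nat l)"
    "Gamma (y + of_nat (Suc l)) = (y + of_nat l) * Gamma (y + of_nat l)"
    using Gamma_plus1[OF not_nonpos_shift[OF assms(1), of l]] Gamma_plus1[OF not_nonpos_shift[OF assms(2), of l]]
    by (simp_all add: add_ac)
  have r: "of_nat (Suc l) * rGamma (1 + of_nat (Suc l)) = (rGamma (1 + of_nat l) :: complex)"
    using rGamma_plus1[of "of_nat (Suc l) :: complex"] by (simp add: add_ac)
  have e: "x + y + of_nat k + of_nat (Suc l) = x + y + of_nat (Suc k) + of_nat l" by simp
  have "of_nat (Suc l) * base_term x y k (Suc l) = Gamma (x + of_nat (Suc l)) * Gamma (y + of_nat (Suc l)) *
      rGamma (x + y + of_nat (Suc k) + of_nat l) * (of_nat (Suc l) * rGamma (1 + of_nat (Suc l)))"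
    unfolding base_term_def e by (simp only: mult_ac)
  then show ?thesis unfolding r g base_term_def by (simp only: mult_ac)
qed

lemma base_term_eq_gauss_term:
  assumes "x \<notin> \<int>\<^sub>\<le>\<^sub>0" "y \<notin> \<int>\<^sub>\<le>\<^sub>0"
  shows "base_term x y k l = Gamma x * Gamma y * gauss_term x y (x + y + of_nat k) l"
proof -
  have r: "rGamma (1 + of_nat l) = (inverse (fact l) :: complex)"
    unfolding rGamma_inverse_Gamma Gamma_fact ..
  have "Gamma x \<noteq> 0" "Gamma y \<noteq> 0" using assms by (simp_all add: Gamma_eq_zero_iff)
  then have g: "Gamma (x + of_nat l) = Gamma x * pochhammer x l" "Gamma (y + of_nat l) = Gamma y * pochhammer y l"
    using pochhammer_Gamma[OF assms(1), of l] pochhammer_Gamma[OF assms(2), of l] by simp_all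
  show ?thesis unfolding base_term_def gauss_term_def g r by (simp only: divide_inverse mult_ac)
qed

lemma base_term_asymp:
  assumes "x \<notin> \<int>\<^sub>\<le>\<^sub>0" "y \<notin> \<int>\<^sub>\<le>\<^sub>0"
  shows "(\<lambda>l. base_term x y k l * of_nat l ^ Suc k) \<longlonglongrightarrow> 1"
proof -
  have "Gamma x \<noteq> 0" "Gamma y \<noteq> 0" using assms by (simp_all add: Gamma_eq_zero_iff)
  then have one: "Gamma x * Gamma y * (rGamma x * rGamma y) = 1" by (simp add: rGamma_inverse_Gamma field_simps)
  have "(\<lambda>l. Gamma x * Gamma y * (gauss_term x y (x + y + of_nat k) l * of_nat l powr (1 + (x + y + of_nat k - x - y))))
      \<longlonglongrightarrow> Gamma x * Gamma y * (rGamma x * rGamma y)"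
    by (intro tendsto_mult tendsto_const gauss_term_asymp)
  moreover have "eventually (\<lambda>l. Gamma x * Gamma y * (gauss_term x y (x + y + of_nat k) l * of_nat l powr (1 + (x + y + of_nat k - x - y)))
      = base_term x y k l * of_nat l ^ Suc k) sequentially"
    using eventually_gt_at_top[of 0]
  proof eventually_elim
    case (elim l)
    have "1 + (x + y + of_nat k - x - y) = of_nat (Suc k)" by simp
    moreover have "of_nat l powr of_nat (Suc k) = (of_nat l ^ Suc k :: complex)"
      using elim powr_nat'[of "of_nat l" "Suc k"] by (simp del: of_nat_Suc)
    ultimately show ?case unfolding base_term_eq_gauss_term[OF assms] by (simp only: mult.assoc)
  qed
  ultimately show ?thesis unfolding one by (rule Lim_transform_eventually)
qed

lemma base_term_bigo:
  assumes "x \<notin> \<int>\<^sub>\<le>\<^sub>0" "y \<notin> \<int>\<^sub>\<le>\<^sub>0"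
  shows "base_term x y k \<in> O(neg_pow (Suc k))"
proof (rule bigoI_tendsto)
  show "(\<lambda>l. base_term x y k l / inverse (of_nat l ^ Suc k)) \<longlonglongrightarrow> 1"
    using base_term_asymp[OF assms, of k] by (simp add: divide_inverse)
  show "eventually (\<lambda>l. inverse (of_nat l ^ Suc k) \<noteq> (0 :: complex)) sequentially"
    using eventually_gt_at_top[of 0] by eventually_elim simp
qed

text \<open>
  After the constant factor \<open>\<Gamma>(x) \<Gamma>(y)\<close> has been taken out, this is a Gauss series with \<open>a = k\<close>.
\<close>

lemma base_term_sums:
  assumes "x \<notin> \<int>\<^sub>\<le>\<^sub>0" "y \<notin> \<int>\<^sub>\<le>\<^sub>0" "k \<ge> 1"
  shows "base_term x y k sums (Gamma (of_nat k) / (pochhammer x k * pochhammer y k))"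
    and "summable (\<lambda>l. norm (base_term x y k l))"
proof -
  have nz: "Gamma x \<noteq> 0" "Gamma y \<noteq> 0" using assms by (simp_all add: Gamma_eq_zero_iff)
  have p: "pochhammer x k \<noteq> 0" "pochhammer y k \<noteq> 0" using assms pochhammer_eq_0_imp_nonpos_Int by blast+
  have one: "Gamma x * Gamma y * (rGamma x * rGamma y) = 1" using nz by (simp add: rGamma_inverse_Gamma field_simps)
  have r: "rGamma (of_nat k + x) = rGamma x / pochhammer x k" "rGamma (of_nat k + y) = rGamma y / pochhammer y k"
    using p pochhammer_rGamma[of x k] pochhammer_rGamma[of y k] by (simp_all add: add_ac)
  have "Gamma x * Gamma y * (Gamma (of_nat k) * rGamma (of_nat k + x) * rGamma (of_nat k + y)) =
      (Gamma x * Gamma y * (rGamma x * rGamma y)) * (Gamma (of_nat k) / (pochhammer x k * pochhammer y k))"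
    unfolding r by (simp add: mult_ac)
  then have e: "Gamma x * Gamma y * (Gamma (of_nat k) * rGamma (of_nat k + x) * rGamma (of_nat k + y)) =
      Gamma (of_nat k) / (pochhammer x k * pochhammer y k)"
    unfolding one by simp
  have "(\<lambda>l. Gamma x * Gamma y * gauss_term x y (x + y + of_nat k) l) sums
      (Gamma x * Gamma y * (Gamma (of_nat k) * rGamma (of_nat k + x) * rGamma (of_nat k + y)))"
    using assms(3) by (intro sums_mult gauss_summation) simp
  then show "base_term x y k sums (Gamma (of_nat k) / (pochhammer x k * pochhammer y k))"
    unfolding e by (simp add: base_term_eq_gauss_term[OF assms(1,2)] fun_eq_iff cong: sums_cong)
  have "summable (\<lambda>l. norm (gauss_term x y (x + y + of_nat k) l))"
    using assms(3) by (intro summable_norm_gauss_term) simp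
  then show "summable (\<lambda>l. norm (base_term x y k l))"
    unfolding base_term_eq_gauss_term[OF assms(1,2)] norm_mult by (intro summable_mult)
qed

section \<open>Expansion of the boundary ratio\<close>

text \<open>
  The ratio \<open>\<Gamma>(x+m) \<Gamma>(y+m) / (\<Gamma>(x+y+m) \<Gamma>(m))\<close>, a boundary term of telescoping sums.
\<close>

definition base_ratio :: "complex \<Rightarrow> complex \<Rightarrow> nat \<Rightarrow> complex" where
  "base_ratio x y m = of_nat m * base_term x y 0 m"

lemma base_ratio_tendsto:
  assumes "x \<notin> \<int>\<^sub>\<le>\<^sub>0" "y \<notin> \<int>\<^sub>\<le>\<^sub>0"
  shows "base_ratio x y \<longlonglongrightarrow> 1"
  using base_term_asymp[OF assms, of 0] by (simp add: base_ratio_def[abs_def] mult.commute)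

lemma base_ratio_eq: "base_ratio x y m = of_nat m * (x + y + of_nat m) * base_term x y 1 m"
  using base_term_lower[of x y 0 m] by (simp add: base_ratio_def)

lemma base_ratio_diff:
  assumes "x \<notin> \<int>\<^sub>\<le>\<^sub>0" "y \<notin> \<int>\<^sub>\<le>\<^sub>0"
  shows "base_ratio x y (Suc m) - base_ratio x y m = x * y * base_term x y 1 m"
  using base_term_raise[OF assms, of m 0] unfolding base_ratio_eq[of x y m]
  by (simp add: base_ratio_def algebra_simps)

lemma base_sum_1:
  assumes "x \<notin> \<int>\<^sub>\<le>\<^sub>0" "y \<notin> \<int>\<^sub>\<le>\<^sub>0"
  shows "x * y * (\<Sum>l<m. base_term x y 1 l) = base_ratio x y m"
proof (induction m)
  case (Suc m)
  then show ?case using base_ratio_diff[OF assms, of m] by (simp add: algebra_simps)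
qed (simp add: base_ratio_def)

lemma base_sum_2:
  assumes "x \<notin> \<int>\<^sub>\<le>\<^sub>0" "y \<notin> \<int>\<^sub>\<le>\<^sub>0"
  shows "(x + 1) * (y + 1) * (\<Sum>l<m. base_term x y 2 l) =
    of_nat m * base_term x y 1 m + (\<Sum>l<m. base_term x y 1 l)"
proof (induction m)
  case (Suc m)
  have r: "of_nat (Suc m) * base_term x y 1 (Suc m) = (x + of_nat m) * (y + of_nat m) * base_term x y 2 m"
    using base_term_raise[OF assms, of m 1] by (simp only: Suc_1 [symmetric] One_nat_def)
  have l: "base_term x y 1 m = (x + y + 1 + of_nat m) * base_term x y 2 m"
    using base_term_lower[of x y 1 m] by (simp add: numeral_2_eq_2)
  have "(x + 1) * (y + 1) * (\<Sum>l<Suc m. base_term x y 2 l) =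
      (x + 1) * (y + 1) * (\<Sum>l<m. base_term x y 2 l) + (x + 1) * (y + 1) * base_term x y 2 m"
    by (simp add: distrib_left)
  also have "\<dots> = of_nat m * base_term x y 1 m + (\<Sum>l<m. base_term x y 1 l) + (x + 1) * (y + 1) * base_term x y 2 m"
    unfolding Suc.IH ..
  also have "\<dots> = (x + of_nat m) * (y + of_nat m) * base_term x y 2 m + (\<Sum>l<Suc m. base_term x y 1 l)"
    unfolding sum.lessThan_Suc l by (simp add: algebra_simps)
  finally show ?case unfolding r .
qed simp

text \<open>
  The formal value of the ratio is the hypergeometric series with upper parameters \<open>x\<close>, \<open>y\<close> and lower parameter
  \<open>1 - m\<close> at the point one; these are its first three terms.
\<close>

definition ratio_expansion :: "complex \<Rightarrow> complex \<Rightarrow> nat \<Rightarrow> complex" where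
  "ratio_expansion x y m = 1 - x * y * inverse (of_nat m - 1)
     + x * (x + 1) * (y * (y + 1)) / 2 * inverse ((of_nat m - 1) * (of_nat m - 2))"

text \<open>
  The proposed expansion satisfies the recurrence of \<open>base_ratio\<close> up to an error of order \<open>n\<^sup>-\<^sup>4\<close>: in the numerator
  all powers of \<open>n\<close> cancel.
\<close>

lemma ratio_expansion_step:
  fixes n s q t :: complex
  assumes "n \<noteq> 0" "n + s \<noteq> 0" "n - 1 \<noteq> 0" "n - 2 \<noteq> 0" and t: "t = q + s + 1"
  defines "w \<equiv> 1 - q * inverse (n - 1) + q * t / 2 * inverse ((n - 1) * (n - 2))"
    and "w' \<equiv> 1 - q * inverse n + q * t / 2 * inverse (n * (n - 1))"
  shows "w * (q * inverse (n * (n + s))) - (w' - w) =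
    (2 * q + 2 * q * q + q * (q * t) / 2 + 2 * s * q + s * (q * t)) * inverse (n * (n + s) * (n - 1) * (n - 2))"
    (is "?L = ?K * inverse ?D")
proof -
  define W where "W = (n - 1) * (n - 2) - q * (n - 2) + q * t / 2"
  have w: "w = W * inverse ((n - 1) * (n - 2))"
  proof -
    have "1 - q * inverse a + r * inverse (a * b) = (a * b - q * b + r) * inverse (a * b)"
      if "a \<noteq> 0" "b \<noteq> 0" for a b r :: complex using that by (simp add: field_simps)
    from this[OF assms(3,4)] show ?thesis unfolding w_def W_def .
  qed
  have d: "w' - w = (q * (n - 2) - q * t) * inverse (n * (n - 1) * (n - 2))"
    unfolding w_def w'_def using assms(1,3,4) by (simp add: divide_simps) (simp add: algebra_simps)
  have "?L = (W * q - (n + s) * (q * (n - 2) - q * t)) * inverse ?D"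
    unfolding d unfolding w using assms(1-4) by (simp add: divide_simps)
  also have "W * q - (n + s) * (q * (n - 2) - q * t) = ?K"
    unfolding W_def t by (simp add: field_simps)
  finally show ?thesis .
qed

lemma eventually_nat_nonzero:
  fixes s :: complex
  shows
  "eventually (\<lambda>m. of_nat m \<noteq> (0 :: complex) \<and> of_nat m + s \<noteq> 0 \<and> of_nat m - 1 \<noteq> (0 :: complex) \<and> of_nat m - 2 \<noteq> (0 :: complex)) sequentially"
  using eventually_gt_at_top[of 0] of_nat_neq_eventually[of s] of_nat_neq_eventually[of "-1"] of_nat_neq_eventually[of "-2"]
  by eventually_elim (simp add: add.commute)

text \<open>
  The error \<open>e\<close> satisfies \<open>e(m+1) - e(m) = O(m\<^sup>-\<^sup>2) e(m) + O(m\<^sup>-\<^sup>4)\<close> and tends to zero. Each use of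
  \<open>bigo_of_differences\<close> improves a bound \<open>O(m\<^sup>-\<^sup>j)\<close> to \<open>O(m\<^sup>-\<^sup>j\<^sup>-\<^sup>1)\<close>, so three steps lead from boundedness to the
  claim.
\<close>

lemma base_ratio_expansion:
  assumes "x \<notin> \<int>\<^sub>\<le>\<^sub>0" "y \<notin> \<int>\<^sub>\<le>\<^sub>0"
  shows "(\<lambda>m. base_ratio x y m - ratio_expansion x y m) \<in> O(neg_pow 3)"
proof -
  define s q t where "s = x + y" and "q = x * y" and "t = (x + 1) * (y + 1)"
  have t: "t = q + s + 1" by (simp add: s_def q_def t_def algebra_simps)
  have qt: "x * (x + 1) * (y * (y + 1)) = q * t" by (simp add: q_def t_def)
  let ?e = "\<lambda>m. base_ratio x y m - ratio_expansion x y m"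
  \<comment> \<open>The constant numerator that \<open>ratio_expansion_step\<close> leaves.\<close>
  define K where "K = 2 * q + 2 * q * q + q * (q * t) / 2 + 2 * s * q + s * (q * t)"
  have diff: "eventually (\<lambda>m. ?e (Suc m) - ?e m = ?e m * (q * inverse ((of_nat m + 0) * (of_nat m + s)))
      + K * inverse ((of_nat m + 0) * (of_nat m + s) * (of_nat m + -1) * (of_nat m + -2))) sequentially"
    using eventually_nat_nonzero[of s]
  proof eventually_elim
    case (elim m)
    have u: "base_term x y 1 m = base_ratio x y m * inverse (of_nat m * (of_nat m + s))"
    proof -
      have r: "base_ratio x y m = base_term x y 1 m * (of_nat m * (of_nat m + s))"
        unfolding base_ratio_eq s_def by (simp only: add_ac mult_ac)
      have nz: "of_nat m * (of_nat m + s) \<noteq> 0" using elim by simp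
      show ?thesis unfolding divide_inverse [symmetric] r by (rule nonzero_mult_div_cancel_right[OF nz, symmetric])
    qed
    have w: "ratio_expansion x y m = 1 - q * inverse (of_nat m - 1) + q * t / 2 * inverse ((of_nat m - 1) * (of_nat m - 2))"
      "ratio_expansion x y (Suc m) = 1 - q * inverse (of_nat m) + q * t / 2 * inverse (of_nat m * (of_nat m - 1))"
      unfolding ratio_expansion_def qt by (simp_all add: q_def)
    have *: "ratio_expansion x y m * (q * inverse (of_nat m * (of_nat m + s))) - (ratio_expansion x y (Suc m) - ratio_expansion x y m) =
        K * inverse (of_nat m * (of_nat m + s) * (of_nat m - 1) * (of_nat m - 2))"
      unfolding w K_def by (rule ratio_expansion_step) (use elim t in auto)
    have "base_ratio x y (Suc m) - base_ratio x y m = q * (base_ratio x y m * inverse (of_nat m * (of_nat m + s)))"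
      unfolding base_ratio_diff[OF assms] u q_def ..
    then show ?case using * by (simp add: algebra_simps)
  qed
  have boot: "?e \<in> O(neg_pow (j + 1))" if "?e \<in> O(neg_pow j)" "?e \<longlonglongrightarrow> 0" "j \<le> 2" for j
  proof (rule bigo_of_differences[OF that(2)])
    have "(\<lambda>m. inverse ((of_nat m + 0) * (of_nat m + s))) \<in> O(neg_pow 2)"
      using bigo_neg_pow_mult[OF inverse_shift_bigo[of 0] inverse_shift_bigo[of s]]
      unfolding one_add_one inverse_mult_distrib .
    then have "(\<lambda>m. q * inverse ((of_nat m + 0) * (of_nat m + s))) \<in> O(neg_pow 2)"
      by (rule bigo_cmult)
    then have 1: "(\<lambda>m. ?e m * (q * inverse ((of_nat m + 0) * (of_nat m + s)))) \<in> O(neg_pow (j + 2))"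
      by (rule bigo_neg_pow_mult[OF that(1)])
    have "neg_pow 4 \<in> O(neg_pow (j + 2))" using that(3) by (intro neg_pow_mono) simp
    then have 2: "(\<lambda>m. K * inverse ((of_nat m + 0) * (of_nat m + s) * (of_nat m + -1) * (of_nat m + -2))) \<in> O(neg_pow (j + 2))"
      using landau_o.big_trans[OF inverse_shift4_bigo] by (intro bigo_cmult) blast
    from landau_o.big.in_cong[OF diff] sum_in_bigo(1)[OF 1 2]
    show "(\<lambda>m. ?e (Suc m) - ?e m) \<in> O(neg_pow (j + 2))" by blast
  qed
  from inverse_shift_tendsto[of "-1"] inverse_shift_tendsto[of "-2"] have inv: "(\<lambda>m. inverse (of_nat m - 1)) \<longlonglongrightarrow> (0 :: complex)" "(\<lambda>m. inverse (of_nat m - 2)) \<longlonglongrightarrow> (0 :: complex)"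
    by simp_all
  have "ratio_expansion x y \<longlonglongrightarrow> 1 - x * y * 0 + x * (x + 1) * (y * (y + 1)) / 2 * (0 * 0)"
    unfolding ratio_expansion_def inverse_mult_distrib by (intro tendsto_intros inv)
  then have lim: "?e \<longlonglongrightarrow> 0"
    using tendsto_diff[OF base_ratio_tendsto[OF assms]] by force
  have e0: "?e \<in> O(neg_pow 0)"
    using lim by (intro bigoI_tendsto[of _ _ 0]) simp_all
  from boot[OF boot[OF boot[OF e0 lim] lim] lim] show ?thesis by (simp add: numeral_3_eq_3)
qed

section \<open>The constant term of the zero-balanced partial sums\<close>

lemma digamma_newton_terms_summable:
  assumes "Re s > 0"
  shows "summable (\<lambda>k. norm (pochhammer (1 - s) k / (fact k * of_nat k)))"
proof (rule summable_norm_of_powr_limit)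
  have ev: "eventually (\<lambda>k. pochhammer (1 - s) k / (fact k * of_nat k powr (1 - s - 1))
      = pochhammer (1 - s) k / (fact k * of_nat k) * of_nat k powr (1 + s)) sequentially"
    using eventually_gt_at_top[of 0]
  proof eventually_elim
    case (elim k)
    have "of_nat k powr (1 + s) = of_nat k * of_nat k powr s" using elim by (simp add: powr_add)
    moreover have "of_nat k powr (1 - s - 1) = inverse (of_nat k powr s)" by (simp add: powr_minus)
    ultimately show ?case using elim by (simp add: field_simps)
  qed
  show "(\<lambda>k. pochhammer (1 - s) k / (fact k * of_nat k) * of_nat k powr (1 + s)) \<longlonglongrightarrow> rGamma (1 - s)"
    by (rule Lim_transform_eventually[OF pochhammer_asymp ev])
qed (use assms in simp)

text \<open>
  Gauss's theorem with \<open>\<alpha> = 1 - s\<close> and \<open>a = s\<close>: the lower parameter is \<open>1 + \<beta>\<close>, and the quotient of the Pochhammer symbols of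
  \<open>\<beta>\<close> and \<open>1 + \<beta>\<close> collapses to \<open>\<beta> / (\<beta> + n)\<close>. The value is the Beta function at \<open>s\<close> and \<open>\<beta>\<close>.
\<close>

lemma beta_series:
  assumes s: "Re s > 0" and \<beta>: "\<beta> \<notin> \<int>\<^sub>\<le>\<^sub>0"
  shows "(\<lambda>n. pochhammer (1 - s) n / (fact n * (\<beta> + of_nat n))) sums (Gamma s * Gamma \<beta> * rGamma (s + \<beta>))"
proof -
  have nz: "rGamma \<beta> \<noteq> 0" using \<beta> by (simp add: rGamma_eq_zero_iff)
  have t: "gauss_term (1 - s) \<beta> (1 - s + \<beta> + s) n / rGamma \<beta> = pochhammer (1 - s) n / (fact n * (\<beta> + of_nat n))" for n
  proof -
    have "rGamma \<beta> = pochhammer \<beta> n * (\<beta> + of_nat n) * rGamma (1 + \<beta> + of_nat n)"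
      using pochhammer_rGamma[of \<beta> "Suc n"] by (simp add: pochhammer_Suc add_ac)
    moreover from this have "\<beta> + of_nat n \<noteq> 0" using nz by auto
    ultimately have r: "pochhammer \<beta> n * rGamma (1 + \<beta> + of_nat n) = rGamma \<beta> / (\<beta> + of_nat n)"
      by (simp add: field_simps)
    have "gauss_term (1 - s) \<beta> (1 - s + \<beta> + s) n = pochhammer (1 - s) n / fact n * (rGamma \<beta> / (\<beta> + of_nat n))"
      unfolding r [symmetric] by (simp add: gauss_term_def)
    then show ?thesis using nz by simp
  qed
  have "(\<lambda>n. gauss_term (1 - s) \<beta> (1 - s + \<beta> + s) n / rGamma \<beta>) sums
      (Gamma s * rGamma (s + (1 - s)) * rGamma (s + \<beta>) / rGamma \<beta>)"
    by (intro sums_divide gauss_summation s)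
  then show ?thesis unfolding t by (simp add: Gamma_def mult_ac divide_inverse)
qed

text \<open>
  In \<open>beta_series\<close> the term \<open>n = 0\<close> is \<open>1 / \<beta>\<close>. Once it is removed, the right-hand side is a difference quotient
  at \<open>\<beta> = 0\<close> of \<open>\<Gamma>(s) \<Gamma>(1 + \<beta>) / \<Gamma>(s + \<beta>)\<close>, whose derivative there is \<open>\<psi>(1) - \<psi>(s)\<close>, and the left-hand
  side converges termwise with an error of at most \<open>|\<beta>|\<close> times a convergent series.
  The default value \<open>0\<close> of a division by zero makes the summand for \<open>k = 0\<close> vanish.
\<close>

lemma digamma_newton_series:
  assumes s: "Re s > 0"
  shows "(\<Sum>k. pochhammer (1 - s) k / (fact k * of_nat k)) = Digamma 1 - Digamma s"
proof -
  define f where "f k = pochhammer (1 - s) k / (fact k * of_nat k)" for k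
  define g where "g \<beta> k = (if k = 0 then 0 else pochhammer (1 - s) k / (fact k * (\<beta> + of_nat k)))" for \<beta> :: complex and k :: nat
  define F where "F \<beta> = Gamma s * Gamma (1 + \<beta>) * rGamma (s + \<beta>)" for \<beta>
  have fs: "summable (\<lambda>k. norm (f k))" unfolding f_def by (rule digamma_newton_terms_summable[OF s])
  have s0: "s \<notin> \<int>\<^sub>\<le>\<^sub>0" by (rule Re_pos_not_nonpos_Ints[OF s])
  have F0: "F 0 = 1" using s0 by (simp add: F_def rGamma_inverse_Gamma Gamma_eq_zero_iff)
  have one: "(1::complex) \<notin> \<int>\<^sub>\<le>\<^sub>0" by (rule Re_pos_not_nonpos_Ints) simp
  have "(F has_field_derivative (Gamma s * (Gamma 1 * Digamma 1) * rGamma s + Gamma s * Gamma 1 * (- rGamma s * Digamma s))) (at 0)"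
    unfolding F_def using s0 one by (auto intro!: derivative_eq_intros)
  moreover have "Gamma s * (Gamma 1 * Digamma 1) * rGamma s + Gamma s * Gamma 1 * (- rGamma s * Digamma s) = Digamma 1 - Digamma s"
    using s0 by (simp add: rGamma_inverse_Gamma Gamma_eq_zero_iff field_simps)
  ultimately have F': "((\<lambda>\<beta>. (F \<beta> - F 0) / (\<beta> - 0)) \<longlongrightarrow> Digamma 1 - Digamma s) (at 0)"
    by (simp only: has_field_derivative_iff)
  \<comment> \<open>Any sequence of positive numbers that tends to zero would do.\<close>
  define \<beta> :: "nat \<Rightarrow> complex" where "\<beta> N = inverse (of_nat (Suc N))" for N
  have \<beta>0: "\<beta> \<longlonglongrightarrow> 0" unfolding \<beta>_def by (rule LIMSEQ_Suc[OF lim_inverse_n])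
  have \<beta>nz: "\<beta> N \<noteq> 0" for N unfolding \<beta>_def using of_nat_neq_0 by simp
  have \<beta>re: "Re (\<beta> N) > 0" and \<beta>real: "\<beta> N = of_real (inverse (real (Suc N)))" for N
    unfolding \<beta>_def by (simp_all del: of_nat_Suc add: of_real_inverse)
  have lim1: "(\<lambda>N. (F (\<beta> N) - F 0) / (\<beta> N - 0)) \<longlonglongrightarrow> Digamma 1 - Digamma s"
    by (rule filterlim_compose[OF F']) (use \<beta>0 \<beta>nz in \<open>auto simp: filterlim_at\<close>)
  have gs: "g (\<beta> N) sums ((F (\<beta> N) - F 0) / (\<beta> N - 0))" for N
  proof -
    have "(\<lambda>n. pochhammer (1 - s) n / (fact n * (\<beta> N + of_nat n))) sums (Gamma s * Gamma (\<beta> N) * rGamma (s + \<beta> N))"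
      by (intro beta_series s Re_pos_not_nonpos_Ints \<beta>re)
    then have "(\<lambda>n. pochhammer (1 - s) n / (fact n * (\<beta> N + of_nat n)) - (if n = 0 then 1 / \<beta> N else 0)) sums
        (Gamma s * Gamma (\<beta> N) * rGamma (s + \<beta> N) - 1 / \<beta> N)"
      by (rule sums_diff) (rule sums_single[of 0 "\<lambda>_. 1 / \<beta> N"])
    moreover have "pochhammer (1 - s) n / (fact n * (\<beta> N + of_nat n)) - (if n = 0 then 1 / \<beta> N else 0) = g (\<beta> N) n" for n
      by (simp add: g_def)
    moreover have "Gamma (1 + \<beta> N) = \<beta> N * Gamma (\<beta> N)"
      using Gamma_plus1[OF Re_pos_not_nonpos_Ints[OF \<beta>re[of N]]] by (simp add: add.commute)
    then have "Gamma s * Gamma (\<beta> N) * rGamma (s + \<beta> N) - 1 / \<beta> N = (F (\<beta> N) - F 0) / (\<beta> N - 0)"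
      unfolding F0 unfolding F_def using \<beta>nz[of N] by (simp add: field_simps)
    ultimately show ?thesis by simp
  qed
  have bound: "norm (g (\<beta> N) k - f k) \<le> norm (\<beta> N) * norm (f k)" for N k
  proof (cases "k = 0")
    case False
    define b where "b = inverse (real (Suc N))"
    have b: "b > 0" "\<beta> N = of_real b" unfolding b_def \<beta>real by simp_all
    have d: "complex_of_real b + of_nat k = of_real (b + real k)" by simp
    have nk: "complex_of_real (b + real k) \<noteq> 0" using b(1) False unfolding of_real_eq_0_iff by linarith
    have "g (\<beta> N) k - f k = - (f k * (of_real b / of_real (b + real k)))"
      unfolding g_def f_def b(2) d using False nk
      by (simp add: field_simps del: of_real_add) (simp add: algebra_simps)
    then have "norm (g (\<beta> N) k - f k) = norm (f k) * (b / (b + real k))"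
      using b(1) by (simp add: norm_mult norm_divide del: of_real_add)
    also have "b / (b + real k) \<le> b / 1" using b(1) False by (intro divide_left_mono) auto
    then have "norm (f k) * (b / (b + real k)) \<le> norm (f k) * b" by (intro mult_left_mono) auto
    finally show ?thesis using b by (simp add: mult.commute)
  qed (simp add: g_def f_def)
  have lim2: "(\<lambda>N. suminf (g (\<beta> N)) - suminf f) \<longlonglongrightarrow> 0"
  proof (rule Lim_null_comparison)
    show "(\<lambda>N. norm (\<beta> N) * (\<Sum>k. norm (f k))) \<longlonglongrightarrow> 0"
      by (intro tendsto_mult_left_zero tendsto_norm_zero \<beta>0)
    show "eventually (\<lambda>N. norm (suminf (g (\<beta> N)) - suminf f) \<le> norm (\<beta> N) * (\<Sum>k. norm (f k))) sequentially"
    proof (rule always_eventually, rule allI)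
      fix N
      have sb: "summable (\<lambda>k. norm (\<beta> N) * norm (f k))" by (intro summable_mult fs)
      have sn: "summable (\<lambda>k. norm (g (\<beta> N) k - f k))"
        by (rule summable_comparison_test'[OF sb, of 0]) (use bound in simp)
      have "suminf (g (\<beta> N)) - suminf f = (\<Sum>k. g (\<beta> N) k - f k)"
        by (rule suminf_diff[OF sums_summable[OF gs] summable_norm_cancel[OF fs]])
      also have "norm \<dots> \<le> (\<Sum>k. norm (g (\<beta> N) k - f k))" by (rule summable_norm[OF sn])
      also have "\<dots> \<le> (\<Sum>k. norm (\<beta> N) * norm (f k))" by (rule suminf_le[OF bound sn sb])
      also have "\<dots> = norm (\<beta> N) * (\<Sum>k. norm (f k))" by (rule suminf_mult[OF fs])
      finally show "norm (suminf (g (\<beta> N)) - suminf f) \<le> norm (\<beta> N) * (\<Sum>k. norm (f k))" .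
    qed
  qed
  have lim3: "(\<lambda>N. suminf (g (\<beta> N))) \<longlonglongrightarrow> Digamma 1 - Digamma s"
    using lim1 unfolding sums_unique[OF gs, symmetric] .
  have "(\<lambda>N. suminf (g (\<beta> N)) - suminf f) \<longlonglongrightarrow> Digamma 1 - Digamma s - suminf f"
    by (intro tendsto_diff lim3 tendsto_const)
  from LIMSEQ_unique[OF this lim2] have "suminf f = Digamma 1 - Digamma s" by simp
  moreover have "f = (\<lambda>k. pochhammer (1 - s) k / (fact k * of_nat k))" by (rule ext) (rule f_def)
  ultimately show ?thesis by (simp only:)
qed

lemma pochhammer_shift_ratio_le:
  assumes "Re x > 0" "k \<ge> 1"
  shows "norm (pochhammer x k) * norm (x + of_nat m) \<le> norm x * norm (pochhammer (x + of_nat m) k)"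
  using assms(2)
proof (induction k rule: nat_induct_at_least)
  case (Suc k)
  have le: "norm (x + of_nat k) \<le> norm (x + of_nat m + of_nat k)"
    unfolding cmod_def using assms by (intro real_sqrt_le_mono add_right_mono power_mono) auto
  have "norm (pochhammer x (Suc k)) * norm (x + of_nat m) = (norm (pochhammer x k) * norm (x + of_nat m)) * norm (x + of_nat k)"
    by (simp add: pochhammer_Suc norm_mult mult_ac)
  also have "\<dots> \<le> (norm x * norm (pochhammer (x + of_nat m) k)) * norm (x + of_nat m + of_nat k)"
    by (intro mult_mono Suc.IH le) auto
  finally show ?case by (simp add: pochhammer_Suc norm_mult mult_ac)
qed simp

lemma Gamma_ratio_telescope:
  fixes x :: complex
  assumes x: "x \<notin> \<int>\<^sub>\<le>\<^sub>0"
  shows "of_nat k * (\<Sum>l<m. Gamma (x + of_nat l) * rGamma (x + 1 + of_nat l + of_nat k)) =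
    inverse (pochhammer x k) - inverse (pochhammer (x + of_nat m) k)"
proof -
  define g where "g l = Gamma (x + of_nat l) * rGamma (x + of_nat l + of_nat k)" for l
  have g: "g l = inverse (pochhammer (x + of_nat l) k)" for l
  proof -
    have xl: "x + of_nat l \<notin> \<int>\<^sub>\<le>\<^sub>0" by (rule not_nonpos_shift[OF x])
    have "pochhammer (x + of_nat l) k \<noteq> 0" using xl pochhammer_eq_0_imp_nonpos_Int by blast
    moreover have "Gamma (x + of_nat l) * rGamma (x + of_nat l) = 1"
      using xl by (simp add: rGamma_inverse_Gamma Gamma_eq_zero_iff)
    ultimately show ?thesis using pochhammer_rGamma[of "x + of_nat l" k]
      by (simp add: g_def field_simps)
  qed
  have step: "of_nat k * (Gamma (x + of_nat l) * rGamma (x + 1 + of_nat l + of_nat k)) = g l - g (Suc l)" for l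
  proof -
    define R where "R = rGamma (x + of_nat l + of_nat k + 1)"
    have r: "rGamma (x + 1 + of_nat l + of_nat k) = R" "rGamma (x + of_nat (Suc l) + of_nat k) = R"
      by (simp_all add: R_def add_ac)
    have r2: "rGamma (x + of_nat l + of_nat k) = (x + of_nat l + of_nat k) * R"
      unfolding R_def rGamma_plus1 ..
    have G: "Gamma (x + of_nat (Suc l)) = (x + of_nat l) * Gamma (x + of_nat l)"
      using Gamma_plus1[OF not_nonpos_shift[OF x, of l]] by (simp add: add_ac)
    show ?thesis unfolding g_def r r2 G by (simp add: algebra_simps)
  qed
  have "of_nat k * (\<Sum>l<m. Gamma (x + of_nat l) * rGamma (x + 1 + of_nat l + of_nat k)) = (\<Sum>l<m. g l - g (Suc l))"
    unfolding sum_distrib_left step ..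
  also have "\<dots> = g 0 - g m" by (rule sum_lessThan_telescope')
  finally show ?thesis unfolding g by simp
qed

text \<open>
  Gauss's theorem expands \<open>\<Gamma>(y + l) / (\<Gamma>(x + y + l) l!)\<close> in the functions \<open>1 / \<Gamma>(x + 1 + l + k)\<close>. After
  multiplication by \<open>\<Gamma>(x + l)\<close> the sum over \<open>l < m\<close> telescopes for each \<open>k > 0\<close>, while \<open>k = 0\<close> contributes
  the terms \<open>1 / (x + l)\<close>.
\<close>

lemma base_sum_0_series:
  assumes x: "Re x > 0" and y: "Re y > 0"
  defines "f \<equiv> \<lambda>k. pochhammer (1 - y) k / (fact k * of_nat k)"
  shows "(\<Sum>l<m. base_term x y 0 l) = (\<Sum>l<m. inverse (x + of_nat l)) + (\<Sum>k. f k)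
    - (\<Sum>k. f k * (pochhammer x k / pochhammer (x + of_nat m) k))"
    and "norm (\<Sum>k. f k * (pochhammer x k / pochhammer (x + of_nat m) k)) \<le> norm x / norm (x + of_nat m) * (\<Sum>k. norm (f k))"
proof -
  have x0: "x \<notin> \<int>\<^sub>\<le>\<^sub>0" by (rule Re_pos_not_nonpos_Ints[OF x])
  have fs: "summable (\<lambda>k. norm (f k))" unfolding f_def by (rule digamma_newton_terms_summable[OF y])
  let ?r = "\<lambda>k. f k * (pochhammer x k / pochhammer (x + of_nat m) k)"
  have bound: "norm (?r k) \<le> norm x / norm (x + of_nat m) * norm (f k)" for k
  proof (cases "k = 0")
    case False
    have xm: "x + of_nat m \<notin> \<int>\<^sub>\<le>\<^sub>0" by (rule not_nonpos_shift[OF x0])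
    then have p: "norm (pochhammer (x + of_nat m) k) > 0" using pochhammer_eq_0_imp_nonpos_Int by auto
    have q: "norm (x + of_nat m) > 0" using xm by auto
    have "norm (pochhammer x k / pochhammer (x + of_nat m) k) \<le> norm x / norm (x + of_nat m)"
      using pochhammer_shift_ratio_le[OF x, of k m] False p q by (simp add: norm_divide field_simps)
    from mult_left_mono[OF this norm_ge_zero[of "f k"]] show ?thesis
      unfolding norm_mult by (simp only: mult.commute)
  qed (simp add: f_def)
  have sb: "summable (\<lambda>k. norm x / norm (x + of_nat m) * norm (f k))" by (intro summable_mult fs)
  have rs: "summable (\<lambda>k. norm (?r k))"
    by (rule summable_comparison_test'[OF sb, of 0]) (use bound in simp)
  have "norm (\<Sum>k. ?r k) \<le> (\<Sum>k. norm (?r k))" by (rule summable_norm[OF rs])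
  also have "\<dots> \<le> (\<Sum>k. norm x / norm (x + of_nat m) * norm (f k))" by (rule suminf_le[OF bound rs sb])
  also have "\<dots> = norm x / norm (x + of_nat m) * (\<Sum>k. norm (f k))" by (rule suminf_mult[OF fs])
  finally show "norm (\<Sum>k. ?r k) \<le> norm x / norm (x + of_nat m) * (\<Sum>k. norm (f k))" .
  define h where "h l k = Gamma (x + of_nat l) * gauss_term x (1 - y) (x + 1 + of_nat l) k" for l k
  have hs: "h l sums base_term x y 0 l" for l
  proof -
    have e: "x + 1 + of_nat l = x + (1 - y) + (y + of_nat l)" by simp
    have "gauss_term x (1 - y) (x + 1 + of_nat l) sums
        (Gamma (y + of_nat l) * rGamma (y + of_nat l + x) * rGamma (y + of_nat l + (1 - y)))"
      unfolding e by (rule gauss_summation) (use y in simp)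
    then have "h l sums (Gamma (x + of_nat l) * (Gamma (y + of_nat l) * rGamma (y + of_nat l + x) * rGamma (y + of_nat l + (1 - y))))"
      unfolding h_def by (rule sums_mult)
    then show ?thesis by (simp add: base_term_def add_ac mult_ac)
  qed
  have hsum: "(\<Sum>l<m. h l k) = (if k = 0 then \<Sum>l<m. inverse (x + of_nat l) else 0) + f k - ?r k" for k
  proof (cases "k = 0")
    case True
    have "h l 0 = inverse (x + of_nat l)" for l
    proof -
      have xl: "x + of_nat l \<notin> \<int>\<^sub>\<le>\<^sub>0" by (rule not_nonpos_shift[OF x0])
      have "x + of_nat l \<noteq> 0" using xl by auto
      moreover have "Gamma (x + of_nat l) \<noteq> 0" using xl by (simp add: Gamma_eq_zero_iff)
      moreover have "Gamma (x + 1 + of_nat l) = (x + of_nat l) * Gamma (x + of_nat l)"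
        using Gamma_plus1[OF xl] by (simp add: add_ac)
      ultimately show ?thesis by (simp add: h_def gauss_term_def rGamma_inverse_Gamma)
    qed
    then show ?thesis using True by (simp add: f_def)
  next
    case False
    let ?T = "\<Sum>l<m. Gamma (x + of_nat l) * rGamma (x + 1 + of_nat l + of_nat k)"
    have p: "pochhammer x k \<noteq> 0" using x0 pochhammer_eq_0_imp_nonpos_Int by blast
    have k: "of_nat k \<noteq> (0 :: complex)" using False by simp
    have "(\<Sum>l<m. h l k) = pochhammer x k * pochhammer (1 - y) k / fact k * ?T"
      unfolding h_def gauss_term_def sum_distrib_left by (intro sum.cong) (simp_all add: mult_ac)
    also have "\<dots> = f k * pochhammer x k * (of_nat k * ?T)"
      unfolding f_def using k by simp
    also have "\<dots> = f k - ?r k"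
      unfolding Gamma_ratio_telescope[OF x0] using p by (simp add: divide_inverse right_diff_distrib)
    finally show ?thesis using False by simp
  qed
  have "(\<lambda>k. \<Sum>l<m. h l k) sums (\<Sum>l<m. base_term x y 0 l)"
    by (intro sums_sum hs)
  moreover have "(\<lambda>k. (if k = 0 then \<Sum>l<m. inverse (x + of_nat l) else 0) + f k - ?r k) sums
      ((\<Sum>l<m. inverse (x + of_nat l)) + (\<Sum>k. f k) - (\<Sum>k. ?r k))"
    by (intro sums_add sums_diff summable_sums summable_norm_cancel[OF fs] summable_norm_cancel[OF rs]) (rule sums_single)
  ultimately show "(\<Sum>l<m. base_term x y 0 l) = (\<Sum>l<m. inverse (x + of_nat l)) + (\<Sum>k. f k) - (\<Sum>k. ?r k)"
    unfolding hsum by (rule sums_unique2)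
qed

lemma Digamma_shift: "Digamma (1 + of_nat m) = Digamma 1 + (\<Sum>l<m. inverse (1 + of_nat l :: complex))"
proof (induction m)
  case (Suc m)
  have "(1 + of_nat m :: complex) \<noteq> 0" using of_nat_neq_0[of m, where 'a = complex] by simp
  from Digamma_plus1[OF this] Suc show ?case by (simp add: add_ac inverse_eq_divide)
qed simp

lemma ln_minus_Digamma_tendsto:
  "(\<lambda>m. of_real (ln (real m)) - Digamma (of_nat m)) \<longlonglongrightarrow> (0 :: complex)"
proof -
  have a: "(\<lambda>m. of_real (ln (real m)) - (\<Sum>l<m. inverse (1 + of_nat l))) \<longlonglongrightarrow> (Digamma 1 :: complex)"
    by (rule Digamma_LIMSEQ) simp
  have "(\<lambda>m. of_real (ln (real m)) - (\<Sum>l<m. inverse (1 + of_nat l)) - Digamma 1 + inverse (of_nat m)) \<longlonglongrightarrow> (Digamma 1 - Digamma 1 + 0 :: complex)"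
    by (intro tendsto_add tendsto_diff a tendsto_const lim_inverse_n)
  moreover have "eventually (\<lambda>m. of_real (ln (real m)) - (\<Sum>l<m. inverse (1 + of_nat l)) - Digamma 1 + inverse (of_nat m)
      = of_real (ln (real m)) - (Digamma (of_nat m) :: complex)) sequentially"
    using eventually_gt_at_top[of 0]
  proof eventually_elim
    case (elim m)
    have "Digamma (of_nat m + 1) = Digamma (of_nat m) + (1 / of_nat m :: complex)" using elim by (intro Digamma_plus1) simp
    then show ?case using Digamma_shift[of m] by (simp add: add_ac inverse_eq_divide algebra_simps)
  qed
  ultimately show ?thesis using Lim_transform_eventually by fastforce
qed

text \<open>
  The constant in the asymptotics of the partial sums for \<open>k = 0\<close>. It is stated as a predicate of the two parameters because it
  is first established in a half-plane and then extended in either parameter.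
\<close>

definition digamma_limit :: "complex \<Rightarrow> complex \<Rightarrow> bool" where
  "digamma_limit x y \<longleftrightarrow> (\<lambda>m. (\<Sum>l<m. base_term x y 0 l) - Digamma (of_nat m)) \<longlonglongrightarrow> Digamma 1 - Digamma x - Digamma y"

lemma digamma_limit_commute: "digamma_limit x y \<longleftrightarrow> digamma_limit y x"
proof -
  have "Digamma 1 - Digamma x - Digamma y = Digamma 1 - Digamma y - Digamma x" by simp
  then show ?thesis unfolding digamma_limit_def base_term_commute[of x y] by metis
qed

lemma digamma_limit_pos:
  assumes x: "Re x > 0" and y: "Re y > 0"
  shows "digamma_limit x y"
proof -
  define f where "f k = pochhammer (1 - y) k / (fact k * of_nat k)" for k
  define R where "R m = (\<Sum>k. f k * (pochhammer x k / pochhammer (x + of_nat m) k))" for m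
  have x0: "x \<noteq> 0" using x by auto
  have S: "(\<Sum>l<m. base_term x y 0 l) = (\<Sum>l<m. inverse (x + of_nat l)) + (Digamma 1 - Digamma y) - R m" for m
    using base_sum_0_series(1)[OF x y, of m] unfolding R_def f_def digamma_newton_series[OF y] .
  have "R \<longlonglongrightarrow> 0"
  proof (rule Lim_null_comparison)
    show "eventually (\<lambda>m. norm (R m) \<le> norm x / norm (x + of_nat m) * (\<Sum>k. norm (f k))) sequentially"
      using base_sum_0_series(2)[OF x y] unfolding R_def f_def by (intro always_eventually allI)
    have "(\<lambda>m. x / (x + of_nat m)) \<longlonglongrightarrow> 0"
      by (intro tendsto_divide_0[OF tendsto_const] tendsto_add_filterlim_at_infinity[OF tendsto_const] tendsto_of_nat)
    then have "(\<lambda>m. norm (x / (x + of_nat m))) \<longlonglongrightarrow> 0" by (rule tendsto_norm_zero)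
    then show "(\<lambda>m. norm x / norm (x + of_nat m) * (\<Sum>k. norm (f k))) \<longlonglongrightarrow> 0"
      unfolding norm_divide by (rule tendsto_mult_left_zero)
  qed
  then have "(\<lambda>m. - (of_real (ln (real m)) - (\<Sum>l<m. inverse (x + of_nat l))) + (Digamma 1 - Digamma y) - R m
      + (of_real (ln (real m)) - Digamma (of_nat m))) \<longlonglongrightarrow> - Digamma x + (Digamma 1 - Digamma y) - 0 + 0"
    by (intro tendsto_add tendsto_diff tendsto_minus Digamma_LIMSEQ x0 tendsto_const ln_minus_Digamma_tendsto)
  then show ?thesis unfolding digamma_limit_def S by (simp add: algebra_simps)
qed

text \<open>
  Lowering \<open>y\<close> by one changes the partial sums by \<open>x\<close> times those for \<open>k = 1\<close>, which tend to \<open>1 / (x y)\<close>. The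
  digamma function changes by the matching amount \<open>1 / y\<close>.
\<close>

lemma digamma_limit_lower:
  assumes x: "x \<notin> \<int>\<^sub>\<le>\<^sub>0" and y: "y \<notin> \<int>\<^sub>\<le>\<^sub>0" and lim: "digamma_limit x (y + 1)"
  shows "digamma_limit x y"
proof -
  have xy: "x \<noteq> 0" "y \<noteq> 0" using x y by auto
  have t: "base_term x y 0 l = base_term x (y + 1) 0 l + x * base_term x y 1 l" for l
  proof -
    have "Gamma (y + 1 + of_nat l) = (y + of_nat l) * Gamma (y + of_nat l)"
      using Gamma_plus1[OF not_nonpos_shift[OF y, of l]] by (simp add: add_ac)
    then have "base_term x (y + 1) 0 l = (y + of_nat l) * base_term x y 1 l"
      by (simp add: base_term_def add_ac mult_ac)
    then show ?thesis using base_term_lower[of x y 0 l] by (simp add: algebra_simps)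
  qed
  have S: "(\<Sum>l<m. base_term x y 0 l) - Digamma (of_nat m) =
      ((\<Sum>l<m. base_term x (y + 1) 0 l) - Digamma (of_nat m)) + base_ratio x y m / y" for m
    unfolding t sum.distrib base_sum_1[OF x y, symmetric] sum_distrib_left [symmetric] using xy by simp
  have "(\<lambda>m. (\<Sum>l<m. base_term x y 0 l) - Digamma (of_nat m)) \<longlonglongrightarrow> (Digamma 1 - Digamma x - Digamma (y + 1)) + 1 / y"
    unfolding S using lim xy unfolding digamma_limit_def
    by (intro tendsto_add tendsto_divide base_ratio_tendsto x y tendsto_const) auto
  moreover have "Digamma 1 - Digamma x - Digamma (y + 1) + 1 / y = Digamma 1 - Digamma x - Digamma y"
    unfolding Digamma_plus1[OF xy(2)] by simp
  ultimately show ?thesis unfolding digamma_limit_def by (simp only:)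
qed

lemma digamma_limit_right:
  assumes "Re x > 0" "y \<notin> \<int>\<^sub>\<le>\<^sub>0"
  shows "digamma_limit x y"
proof -
  have x: "x \<notin> \<int>\<^sub>\<le>\<^sub>0" by (rule Re_pos_not_nonpos_Ints) fact
  have *: "digamma_limit x y" if "Re y + real N > 0" "y \<notin> \<int>\<^sub>\<le>\<^sub>0" for N y
    using that
  proof (induction N arbitrary: y)
    case 0
    then show ?case using digamma_limit_pos assms(1) by simp
  next
    case (Suc N)
    have "y + 1 \<notin> \<int>\<^sub>\<le>\<^sub>0" using not_nonpos_shift[OF Suc.prems(2), of 1] by simp
    then have "digamma_limit x (y + 1)" using Suc by simp
    then show ?case by (rule digamma_limit_lower[OF x Suc.prems(2)])
  qed
  obtain N :: nat where "norm y < real N" using reals_Archimedean2 by blast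
  then have "Re y + real N > 0" using abs_Re_le_cmod[of y] by simp
  from *[OF this assms(2)] show ?thesis .
qed

lemma digamma_limit_general:
  assumes "x \<notin> \<int>\<^sub>\<le>\<^sub>0" "y \<notin> \<int>\<^sub>\<le>\<^sub>0"
  shows "digamma_limit x y"
proof -
  have *: "digamma_limit y x" if "Re x + real N > 0" "x \<notin> \<int>\<^sub>\<le>\<^sub>0" for N x
    using that
  proof (induction N arbitrary: x)
    case 0
    then show ?case using digamma_limit_right[of x y] assms(2) digamma_limit_commute by simp
  next
    case (Suc N)
    have "x + 1 \<notin> \<int>\<^sub>\<le>\<^sub>0" using not_nonpos_shift[OF Suc.prems(2), of 1] by simp
    then have "digamma_limit y (x + 1)" using Suc by simp
    then show ?case by (rule digamma_limit_lower[OF assms(2) Suc.prems(2)])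
  qed
  obtain N :: nat where "norm x < real N" using reals_Archimedean2 by blast
  then have "Re x + real N > 0" using abs_Re_le_cmod[of x] by simp
  from *[OF this assms(1)] show ?thesis using digamma_limit_commute by blast
qed

section \<open>Expansions of the first three partial sums\<close>

text \<open>
  The partial sums increase by \<open>base_ratio x y m / m\<close>. The expansion of the ratio, divided by \<open>m\<close>, is exactly
  the difference of the asserted expression, so that \<open>bigo_of_differences\<close> applies.
\<close>

lemma base_sum_0_expansion:
  assumes x: "x \<notin> \<int>\<^sub>\<le>\<^sub>0" and y: "y \<notin> \<int>\<^sub>\<le>\<^sub>0"
  shows "(\<lambda>m. (\<Sum>l<m. base_term x y 0 l) - (Digamma 1 - Digamma x - Digamma y + Digamma (of_nat m)
      + x * y * inverse (of_nat m - 1)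
      - x * (x + 1) * (y * (y + 1)) / 4 * inverse ((of_nat m - 1) * (of_nat m - 2)))) \<in> O(neg_pow 3)"
    (is "?E \<in> _")
proof -
  define q where "q = x * y"
  define \<kappa> where "\<kappa> = x * (x + 1) * (y * (y + 1))"
  let ?e = "\<lambda>m. base_ratio x y m - ratio_expansion x y m"
  have lim: "?E \<longlonglongrightarrow> 0"
  proof -
    have "(\<lambda>m. ((\<Sum>l<m. base_term x y 0 l) - Digamma (of_nat m)) - (Digamma 1 - Digamma x - Digamma y)
        - q * inverse (of_nat m + -1) + \<kappa> / 4 * (inverse (of_nat m + -1) * inverse (of_nat m + -2)))
        \<longlonglongrightarrow> (Digamma 1 - Digamma x - Digamma y) - (Digamma 1 - Digamma x - Digamma y) - q * 0 + \<kappa> / 4 * (0 * 0)"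
      by (intro tendsto_add tendsto_diff tendsto_mult tendsto_const inverse_shift_tendsto
          digamma_limit_general[OF x y, unfolded digamma_limit_def])
    then show ?thesis unfolding q_def [symmetric] \<kappa>_def [symmetric] inverse_mult_distrib
      by (simp add: algebra_simps)
  qed
  have diff: "eventually (\<lambda>m. ?E (Suc m) - ?E m = ?e m * inverse (of_nat m + 0)) sequentially"
    using eventually_nat_nonzero[of 0]
  proof eventually_elim
    case (elim m)
    define n where "n = (of_nat m :: complex)"
    have n: "n \<noteq> 0" "n - 1 \<noteq> 0" "n - 2 \<noteq> 0" using elim by (auto simp: n_def)
    have n': "of_nat (Suc m) = n + 1" by (simp add: n_def)
    have D: "Digamma (n + 1) = Digamma n + inverse n" using Digamma_plus1[OF n(1)] by (simp add: inverse_eq_divide)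
    have u: "base_term x y 0 m = base_ratio x y m * inverse n"
      using n(1) by (simp add: base_ratio_def n_def)
    have i2: "inverse (n * (n - 1)) = inverse ((n - 1) * (n - 2)) - 2 * (inverse ((n - 1) * (n - 2)) * inverse n)"
      using n by (simp add: divide_simps)
    define I where "I = inverse ((n - 1) * (n - 2))"
    define I' where "I' = inverse (n * (n - 1))"
    have nn: "n + 1 - 1 = n" "n + 1 - 2 = n - 1" by simp_all
    have "?E (Suc m) - ?E m = base_ratio x y m * inverse n - inverse n
        - q * (inverse n - inverse (n - 1)) + \<kappa> / 4 * (I' - I)"
      unfolding sum.lessThan_Suc n' D u n_def [symmetric] nn q_def [symmetric] \<kappa>_def [symmetric]
        I_def [symmetric] I'_def [symmetric]
      by (simp add: algebra_simps diff_divide_distrib)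
    also have "inverse n - inverse (n - 1) = - (inverse (n - 1) * inverse n)"
      unfolding inverse_diff_inverse[OF n(1,2)] by simp
    also have "I' - I = - 2 * (I * inverse n)" unfolding I_def I'_def i2 by simp
    also have "base_ratio x y m * inverse n - inverse n - q * - (inverse (n - 1) * inverse n) + \<kappa> / 4 * (- 2 * (I * inverse n))
        = (base_ratio x y m - (1 - q * inverse (n - 1) + \<kappa> / 2 * I)) * inverse n"
      by (simp add: left_diff_distrib distrib_right)
    finally show ?case unfolding ratio_expansion_def q_def \<kappa>_def n_def I_def by simp
  qed
  have "(\<lambda>m. ?e m * inverse (of_nat m + 0)) \<in> O(neg_pow (3 + 1))"
    by (intro bigo_neg_pow_mult base_ratio_expansion x y inverse_shift_bigo)
  then have "(\<lambda>m. ?E (Suc m) - ?E m) \<in> O(neg_pow (2 + 2))"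
    using landau_o.big.in_cong[OF diff] by simp
  from bigo_of_differences[OF lim this] show ?thesis by simp
qed

lemma base_sum_1_expansion:
  assumes x: "x \<notin> \<int>\<^sub>\<le>\<^sub>0" and y: "y \<notin> \<int>\<^sub>\<le>\<^sub>0"
  shows "(\<lambda>m. (\<Sum>l<m. base_term x y 1 l) - (1 / (x * y) - inverse (of_nat m - 1)
      + (x + 1) * (y + 1) / 2 * inverse ((of_nat m - 1) * (of_nat m - 2)))) \<in> O(neg_pow 3)"
proof -
  have nz: "x \<noteq> 0" "y \<noteq> 0" using x y by auto
  have eq: "(\<Sum>l<m. base_term x y 1 l) - (1 / (x * y) - inverse (of_nat m - 1)
      + (x + 1) * (y + 1) / 2 * inverse ((of_nat m - 1) * (of_nat m - 2))) =
      inverse (x * y) * (base_ratio x y m - ratio_expansion x y m)" for m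
  proof -
    have cancel: "inverse (x * y) * (x * y * z) = z" for z using nz by (simp add: field_simps)
    have "inverse (x * y) * base_ratio x y m = (\<Sum>l<m. base_term x y 1 l)"
      unfolding base_sum_1[OF x y, symmetric] by (rule cancel)
    moreover have "ratio_expansion x y m = 1 + x * y * (- inverse (of_nat m - 1) + (x + 1) * (y + 1) / 2 * inverse ((of_nat m - 1) * (of_nat m - 2)))"
      unfolding ratio_expansion_def by (simp add: algebra_simps)
    then have "inverse (x * y) * ratio_expansion x y m = 1 / (x * y) + (- inverse (of_nat m - 1) + (x + 1) * (y + 1) / 2 * inverse ((of_nat m - 1) * (of_nat m - 2)))"
      by (simp only: distrib_left[of "inverse (x * y)"] cancel divide_inverse mult_1_left mult_1_right)
    ultimately show ?thesis unfolding right_diff_distrib by simp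
  qed
  show ?thesis unfolding eq by (intro bigo_cmult base_ratio_expansion x y)
qed

lemma second_order_cancellation:
  fixes n s q t :: complex
  assumes "n + s \<noteq> 0" "n - 1 \<noteq> 0" "n - 2 \<noteq> 0" and t: "t = q + s + 1"
  shows "(1 - q * inverse (n - 1) + q * t / 2 * inverse ((n - 1) * (n - 2))) * inverse (n + s)
      + (- inverse (n - 1) + t / 2 * inverse ((n - 1) * (n - 2))) + t / 2 * inverse ((n - 1) * (n - 2))
    = (2 + 2 * q + q * t / 2 + 2 * s + s * t) * inverse ((n + s) * (n - 1) * (n - 2))"
proof -
  have "(1 - q * inverse a + q * t / 2 * inverse (a * b)) * inverse c + (- inverse a + t / 2 * inverse (a * b)) + t / 2 * inverse (a * b)
    = (a * b - q * b + q * t / 2 - c * b + c * t) * inverse (c * a * b)"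
    if "a \<noteq> 0" "b \<noteq> 0" "c \<noteq> 0" for a b c :: complex
    using that by (simp add: field_simps)
  from this[OF assms(2,3,1)] show ?thesis
    unfolding t by (simp add: algebra_simps)
qed

lemma base_sum_2_expansion:
  assumes x: "x \<notin> \<int>\<^sub>\<le>\<^sub>0" and y: "y \<notin> \<int>\<^sub>\<le>\<^sub>0"
  shows "(\<lambda>m. (\<Sum>l<m. base_term x y 2 l) - (1 / (x * (x + 1) * (y * (y + 1)))
      - 1 / 2 * inverse ((of_nat m - 1) * (of_nat m - 2)))) \<in> O(neg_pow 3)"
    (is "?E \<in> _")
proof -
  define s q t where "s = x + y" and "q = x * y" and "t = (x + 1) * (y + 1)"
  have t: "t = q + s + 1" by (simp add: s_def q_def t_def algebra_simps)
  have qt: "x * (x + 1) * (y * (y + 1)) = q * t" by (simp add: q_def t_def)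
  have "x + 1 \<noteq> 0" "y + 1 \<noteq> 0" using not_nonpos_shift[OF x, of 1] not_nonpos_shift[OF y, of 1] by auto
  then have nz: "q \<noteq> 0" "t \<noteq> 0" using x y by (auto simp: q_def t_def)
  define K where "K = 2 + 2 * q + q * t / 2 + 2 * s + s * t"
  let ?e = "\<lambda>m. base_ratio x y m - ratio_expansion x y m"
  let ?S1 = "\<lambda>m. (\<Sum>l<m. base_term x y 1 l) - (1 / (x * y) - inverse (of_nat m - 1)
      + (x + 1) * (y + 1) / 2 * inverse ((of_nat m - 1) * (of_nat m - 2)))"
  have ev: "eventually (\<lambda>m. ?E m = inverse t * ((?e m * inverse (of_nat m + s) + ?S1 m)
      + K * inverse ((of_nat m + s) * (of_nat m + -1) * (of_nat m + -2)))) sequentially"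
    using eventually_nat_nonzero[of s]
  proof eventually_elim
    case (elim m)
    define n where "n = (of_nat m :: complex)"
    have n: "n \<noteq> 0" "n + s \<noteq> 0" "n - 1 \<noteq> 0" "n - 2 \<noteq> 0" using elim by (auto simp: n_def)
    define I where "I = inverse ((n - 1) * (n - 2))"
    define J where "J = inverse (n - 1)"
    have v: "of_nat m * base_term x y 1 m = base_ratio x y m * inverse (n + s)"
    proof -
      have r: "base_ratio x y m = of_nat m * base_term x y 1 m * (n + s)"
        unfolding base_ratio_eq s_def n_def by (simp only: add_ac mult_ac)
      show ?thesis unfolding r mult.assoc right_inverse[OF n(2)] by simp
    qed
    have w: "ratio_expansion x y m = 1 - q * J + q * t / 2 * I"
      unfolding ratio_expansion_def qt I_def J_def n_def by (simp add: q_def)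
    have can: "(1 - q * J + q * t / 2 * I) * inverse (n + s) + (- J + t / 2 * I) + t / 2 * I
      = K * inverse ((n + s) * (n - 1) * (n - 2))"
      unfolding I_def J_def K_def by (rule second_order_cancellation[OF n(2,3,4) t])
    have s2: "t * (\<Sum>l<m. base_term x y 2 l) = base_ratio x y m * inverse (n + s) + (\<Sum>l<m. base_term x y 1 l)"
      using base_sum_2[OF x y, of m] unfolding v t_def .
    have "t * ((\<Sum>l<m. base_term x y 2 l) - (1 / (q * t) - 1 / 2 * I)) =
        base_ratio x y m * inverse (n + s) + (\<Sum>l<m. base_term x y 1 l) - 1 / q + t / 2 * I"
      unfolding right_diff_distrib s2 using nz by (simp add: field_simps)
    also have "\<dots> = ((base_ratio x y m - (1 - q * J + q * t / 2 * I)) * inverse (n + s) + ((\<Sum>l<m. base_term x y 1 l) - (1 / q - J + t / 2 * I)))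
        + ((1 - q * J + q * t / 2 * I) * inverse (n + s) + (- J + t / 2 * I) + t / 2 * I)"
      by (simp add: algebra_simps)
    finally have "t * ((\<Sum>l<m. base_term x y 2 l) - (1 / (q * t) - 1 / 2 * I)) =
        ((base_ratio x y m - ratio_expansion x y m) * inverse (n + s) + ((\<Sum>l<m. base_term x y 1 l) - (1 / q - J + t / 2 * I)))
        + K * inverse ((n + s) * (n - 1) * (n - 2))"
      unfolding can w .
    then have "(\<Sum>l<m. base_term x y 2 l) - (1 / (q * t) - 1 / 2 * I) = inverse t *
        (((base_ratio x y m - ratio_expansion x y m) * inverse (n + s) + ((\<Sum>l<m. base_term x y 1 l) - (1 / q - J + t / 2 * I)))
        + K * inverse ((n + s) * (n - 1) * (n - 2)))"
      using nz(2) by (metis left_inverse mult.assoc mult_1_left)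
    then show ?case unfolding I_def J_def n_def qt q_def [symmetric] t_def [symmetric] by simp
  qed
  have "(\<lambda>m. ?e m * inverse (of_nat m + s)) \<in> O(neg_pow (3 + 1))"
    by (intro bigo_neg_pow_mult base_ratio_expansion x y inverse_shift_bigo)
  moreover have "neg_pow (3 + 1) \<in> O(neg_pow 3)" by (rule neg_pow_mono) simp
  ultimately have "(\<lambda>m. ?e m * inverse (of_nat m + s)) \<in> O(neg_pow 3)" by (rule landau_o.big_trans)
  then have "(\<lambda>m. inverse t * ((?e m * inverse (of_nat m + s) + ?S1 m)
      + K * inverse ((of_nat m + s) * (of_nat m + -1) * (of_nat m + -2)))) \<in> O(neg_pow 3)"
    by (intro bigo_cmult sum_in_bigo(1) base_sum_1_expansion x y inverse_shift3_bigo)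
  with landau_o.big.in_cong[OF ev] show ?thesis by blast
qed

section \<open>Summation of the factorial series\<close>

text \<open>
  The terms \<open>k < 3\<close> are treated by their explicit expansions. For the others,
  \<open>rGamma_shift_ratio_le\<close> bounds the sum over \<open>k\<close> at \<open>l\<close> by a multiple of \<open>u\<^sub>3(l)\<close>, which has order \<open>l\<^sup>-\<^sup>4\<close>. This
  permits the interchange of summations, which gives the series over \<open>k \<ge> 3\<close>, and bounds the remainder.
\<close>

lemma factorial_series_partial_sums:
  fixes A :: "nat \<Rightarrow> complex"
  assumes x: "x \<notin> \<int>\<^sub>\<le>\<^sub>0" and y: "y \<notin> \<int>\<^sub>\<le>\<^sub>0" and A0: "A 0 = 1"
    and summ: "\<And>l. fac_summable (x + y + of_nat l) A"
  defines "c \<equiv> \<lambda>k. Gamma (of_nat k) / (pochhammer x k * pochhammer y k) * A k"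
  shows "summable (\<lambda>k. c (Suc k))"
    and "(\<lambda>m. (\<Sum>l<m. \<Sum>k. A k * base_term x y k l) -
           ((\<Sum>k. c (Suc k)) + Digamma 1 - Digamma x - Digamma y + Digamma (of_nat m)
            + (x * y - A 1) * inverse (of_nat m - 1)
            - 1 / 4 * (x * (x + 1) * (y * (y + 1)) - 2 * (x + 1) * (y + 1) * A 1 + 2 * A 2)
                * inverse ((of_nat m - 1) * (of_nat m - 2)))) \<in> O(neg_pow 3)"
proof -
  define F where "F l k = A (k + 3) * base_term x y (k + 3) l" for l k
  define r where "r l = (\<Sum>k. F l k)" for l
  have term_summable: "summable (\<lambda>k. norm (A k * base_term x y k l))" for l
  proof -
    have eq: "A k * base_term x y k l = Gamma (x + of_nat l) * Gamma (y + of_nat l) * rGamma (1 + of_nat l) * (A k * rGamma (x + y + of_nat l + of_nat k))" for k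
      by (simp add: base_term_def add_ac mult_ac)
    show ?thesis unfolding eq norm_mult[of "_ * rGamma (1 + of_nat l)"]
      using summ[of l] unfolding fac_summable_def by (rule summable_mult)
  qed
  have F_summable: "summable (\<lambda>k. norm (F l k))" for l
    unfolding F_def using summable_ignore_initial_segment[OF term_summable[of l], of 3] .
  \<comment> \<open>The tail bound needs an argument in the right half-plane. The finitely many rows \<open>l < N0\<close> affect neither convergence nor order.\<close>
  obtain N0 :: nat where N0: "Re (x + y + of_nat N0) > 0"
  proof -
    obtain N0 :: nat where "norm (x + y) < real N0" using reals_Archimedean2 by blast
    then show ?thesis using that[of N0] abs_Re_le_cmod[of "x + y"] by simp
  qed
  define z where "z = x + y + of_nat N0"
  have "z + of_nat 3 \<notin> \<int>\<^sub>\<le>\<^sub>0" by (rule Re_pos_not_nonpos_Ints) (use N0 in \<open>simp add: z_def\<close>)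
  then have rz: "norm (rGamma (z + of_nat 3)) > 0" unfolding zero_less_norm_iff rGamma_eq_zero_iff .
  let ?B = "\<lambda>k. norm (A (k + 3) * rGamma (z + of_nat (k + 3)))"
  have B_summable: "summable ?B"
    using summable_ignore_initial_segment[OF summ[of N0, unfolded fac_summable_def], of 3] unfolding z_def .
  define B where "B = (\<Sum>k. ?B k) / norm (rGamma (z + of_nat 3))"
  have row: "(\<Sum>k. norm (F l k)) \<le> B * norm (base_term x y 3 l)" if "l \<ge> N0" for l
  proof -
    define M where "M = l - N0"
    have l: "l = N0 + M" using that by (simp add: M_def)
    have le: "norm (F l k) \<le> ?B k * (norm (base_term x y 3 l) / norm (rGamma (z + of_nat 3)))" for k
    proof -
      define G where "G = norm (Gamma (x + of_nat l) * Gamma (y + of_nat l) * rGamma (1 + of_nat l))"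
      have G: "norm (base_term x y j l) = G * norm (rGamma (z + of_nat M + of_nat j))" for j
      proof -
        have "base_term x y j l = Gamma (x + of_nat l) * Gamma (y + of_nat l) * rGamma (1 + of_nat l) * rGamma (z + of_nat M + of_nat j)"
          by (simp add: base_term_def z_def l add_ac mult_ac)
        then show ?thesis unfolding G_def by (simp only: norm_mult)
      qed
      have "norm (rGamma (z + of_nat M + of_nat (k + 3))) * norm (rGamma (z + of_nat 3))
          \<le> norm (rGamma (z + of_nat (k + 3))) * norm (rGamma (z + of_nat M + of_nat 3))"
        by (rule rGamma_shift_ratio_le) (use N0 in \<open>auto simp: z_def\<close>)
      then have "norm (rGamma (z + of_nat M + of_nat (k + 3)))
          \<le> norm (rGamma (z + of_nat (k + 3))) * norm (rGamma (z + of_nat M + of_nat 3)) / norm (rGamma (z + of_nat 3))"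
        using rz by (simp only: pos_le_divide_eq)
      then have "(norm (A (k + 3)) * G) * norm (rGamma (z + of_nat M + of_nat (k + 3))) \<le> (norm (A (k + 3)) * G) *
          (norm (rGamma (z + of_nat (k + 3))) * norm (rGamma (z + of_nat M + of_nat 3)) / norm (rGamma (z + of_nat 3)))"
        by (rule mult_left_mono) (simp add: G_def)
      then show ?thesis unfolding F_def norm_mult G by (simp only: divide_inverse mult_ac)
    qed
    have sb: "summable (\<lambda>k. ?B k * (norm (base_term x y 3 l) / norm (rGamma (z + of_nat 3))))"
      by (intro summable_mult2 B_summable)
    have "(\<Sum>k. norm (F l k)) \<le> (\<Sum>k. ?B k * (norm (base_term x y 3 l) / norm (rGamma (z + of_nat 3))))"
      by (rule suminf_le[OF le F_summable sb])
    also have "\<dots> = B * norm (base_term x y 3 l)"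
      unfolding B_def suminf_mult2[OF B_summable, symmetric] by simp
    finally show ?thesis .
  qed
  have row_nonneg: "(\<Sum>k. norm (F l k)) \<ge> 0" for l using F_summable by (simp add: suminf_nonneg)
  have row_summable: "summable (\<lambda>l. \<Sum>k. norm (F l k))"
  proof (rule summable_comparison_test'[where N = N0])
    show "summable (\<lambda>l. B * norm (base_term x y 3 l))"
      by (intro summable_mult base_term_sums(2) x y) simp
    show "norm (\<Sum>k. norm (F l k)) \<le> B * norm (base_term x y 3 l)" if "l \<ge> N0" for l
      using row[OF that] row_nonneg[of l] by simp
  qed
  \<comment> \<open>Interchanging the summations gives the terms of the series over \<open>k\<close>, by \<open>base_term_sums\<close>.\<close>
  note swap = iterated_series_swap[of F, OF F_summable row_summable]
  have col: "(\<Sum>l. F l k) = c (k + 3)" for k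
  proof -
    have "(\<lambda>l. A (k + 3) * base_term x y (k + 3) l) sums
        (A (k + 3) * (Gamma (of_nat (k + 3)) / (pochhammer x (k + 3) * pochhammer y (k + 3))))"
      by (intro sums_mult base_term_sums(1) x y) simp
    from sums_unique[OF this] show ?thesis unfolding F_def c_def by (simp only: mult.commute)
  qed
  have c3: "(\<lambda>k. c (k + 3)) sums (\<Sum>l. r l)" using swap unfolding col r_def .
  have c3': "(\<lambda>k. c (Suc (k + 2))) sums (\<Sum>l. r l)" using c3 by (simp add: numeral_3_eq_3)
  then show c_summable: "summable (\<lambda>k. c (Suc k))"
    using summable_iff_shift[of "\<lambda>k. c (Suc k)" 2] sums_summable by blast
  have c_sum: "(\<Sum>k. c (Suc k)) = c 1 + c 2 + (\<Sum>l. r l)"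
    using suminf_split_initial_segment[OF c_summable, of 2] sums_unique[OF c3']
    by (simp add: numeral_2_eq_2)
  have r_le: "norm (r l) \<le> (\<Sum>k. norm (F l k))" for l
    unfolding r_def by (rule summable_norm[OF F_summable])
  have r_summable: "summable r"
    by (rule summable_norm_cancel[OF summable_comparison_test'[OF row_summable, of 0]]) (use r_le in simp)
  have "r \<in> O(base_term x y 3)"
    by (rule bigoI[of _ B], rule eventually_sequentiallyI[of N0]) (use r_le row order_trans in blast)
  then have r_bigo: "r \<in> O(neg_pow 4)"
    using landau_o.big_trans base_term_bigo[OF x y, of 3] by (simp add: numeral_eq_Suc) blast
  define X where "X m = (\<Sum>l<m. r l) - (\<Sum>l. r l)" for m
  have "X \<longlonglongrightarrow> (\<Sum>l. r l) - (\<Sum>l. r l)"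
    unfolding X_def by (intro tendsto_diff summable_LIMSEQ r_summable tendsto_const)
  then have X_lim: "X \<longlonglongrightarrow> 0" by simp
  have "(\<lambda>m. X (Suc m) - X m) \<in> O(neg_pow (2 + 2))"
    using r_bigo by (simp add: X_def)
  from bigo_of_differences[OF X_lim this] have X_bigo: "X \<in> O(neg_pow 3)" by simp
  have t: "(\<Sum>k. A k * base_term x y k l) = base_term x y 0 l + A 1 * base_term x y 1 l + A 2 * base_term x y 2 l + r l" for l
    using suminf_split_initial_segment[OF summable_norm_cancel[OF term_summable[of l]], of 3] A0
    unfolding r_def F_def by (simp add: numeral_3_eq_3 numeral_2_eq_2)
  define E0 E1 E2 where
    "E0 m = (\<Sum>l<m. base_term x y 0 l) - (Digamma 1 - Digamma x - Digamma y + Digamma (of_nat m)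
      + x * y * inverse (of_nat m - 1)
      - x * (x + 1) * (y * (y + 1)) / 4 * inverse ((of_nat m - 1) * (of_nat m - 2)))" and
    "E1 m = (\<Sum>l<m. base_term x y 1 l) - (1 / (x * y) - inverse (of_nat m - 1)
      + (x + 1) * (y + 1) / 2 * inverse ((of_nat m - 1) * (of_nat m - 2)))" and
    "E2 m = (\<Sum>l<m. base_term x y 2 l) - (1 / (x * (x + 1) * (y * (y + 1)))
      - 1 / 2 * inverse ((of_nat m - 1) * (of_nat m - 2)))" for m
  have c12: "c 1 = A 1 * (1 / (x * y))" "c 2 = A 2 * (1 / (x * (x + 1) * (y * (y + 1))))"
  proof -
    have "Gamma (2 :: complex) = 1" using Gamma_fact[of 1, where 'a = complex] by simp
    then show "c 2 = A 2 * (1 / (x * (x + 1) * (y * (y + 1))))"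
      unfolding c_def by (simp add: numeral_2_eq_2 pochhammer_Suc)
  qed (simp add: c_def)
  have "(\<Sum>l<m. \<Sum>k. A k * base_term x y k l) -
           ((\<Sum>k. c (Suc k)) + Digamma 1 - Digamma x - Digamma y + Digamma (of_nat m)
            + (x * y - A 1) * inverse (of_nat m - 1)
            - 1 / 4 * (x * (x + 1) * (y * (y + 1)) - 2 * (x + 1) * (y + 1) * A 1 + 2 * A 2)
                * inverse ((of_nat m - 1) * (of_nat m - 2)))
      = E0 m + A 1 * E1 m + A 2 * E2 m + X m" for m
  proof -
    define I where "I = inverse ((of_nat m - 1) * (of_nat m - 2) :: complex)"
    define J where "J = inverse (of_nat m - 1 :: complex)"
    define \<kappa> where "\<kappa> = x * (x + 1) * (y * (y + 1))"
    define \<tau> where "\<tau> = (x + 1) * (y + 1)"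
    have \<tau>': "2 * (x + 1) * (y + 1) = 2 * \<tau>" by (simp add: \<tau>_def)
    show ?thesis
      unfolding t sum.distrib sum_distrib_left [symmetric] c_sum c12 E0_def E1_def E2_def X_def
        I_def [symmetric] J_def [symmetric] \<kappa>_def [symmetric] \<tau>' \<tau>_def [symmetric]
      by (simp add: algebra_simps)
  qed
  moreover have "(\<lambda>m. E0 m + A 1 * E1 m + A 2 * E2 m + X m) \<in> O(neg_pow 3)"
    unfolding E0_def E1_def E2_def
    by (intro sum_in_bigo(1) bigo_cmult X_bigo base_sum_0_expansion base_sum_1_expansion base_sum_2_expansion x y)
  ultimately show "(\<lambda>m. (\<Sum>l<m. \<Sum>k. A k * base_term x y k l) -
           ((\<Sum>k. c (Suc k)) + Digamma 1 - Digamma x - Digamma y + Digamma (of_nat m)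
            + (x * y - A 1) * inverse (of_nat m - 1)
            - 1 / 4 * (x * (x + 1) * (y * (y + 1)) - 2 * (x + 1) * (y + 1) * A 1 + 2 * A 2)
                * inverse ((of_nat m - 1) * (of_nat m - 2)))) \<in> O(neg_pow 3)"
    by (simp only:)
qed

lemma coeff_excess_shift:
  assumes "p \<ge> 1"
  shows "coeff_excess p (\<lambda>i. a i + z) (\<lambda>i. b i + z) = coeff_excess p a b + z"
proof -
  obtain q where "p = Suc q" using assms by (cases p) auto
  then show ?thesis by (simp add: coeff_excess_def sum.distrib algebra_simps)
qed

lemma hyp_term_eq_series:
  assumes p: "p \<ge> 1" and pos: "\<And>j. j \<in> {3..p+1} \<Longrightarrow> Re (a j) > 0"
    and s: "coeff_excess p a b = a 1 + a 2"
  shows "fac_summable (a 1 + a 2 + of_nat l) (A_coeff p a b)"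
    and "hyp_term p a b l = (\<Sum>k. A_coeff p a b k * base_term (a 1) (a 2) k l)"
proof -
  let ?a = "\<lambda>i. a i + of_nat l" and ?b = "\<lambda>i. b i + of_nat l"
  have pos': "Re (?a j) > 0" if "j \<in> {3..p+1}" for j using pos[OF that] by simp
  note R = A_coeff_factorial_series[where a = ?a and b = ?b, OF p pos', unfolded coeff_excess_shift[OF p] A_coeff_shift[OF p] s]
  show f: "fac_summable (a 1 + a 2 + of_nat l) (A_coeff p a b)"
    using R(1)[where r = 0] by simp
  have prod: "(\<Prod>j=1..p+1. Gamma (?a j)) = Gamma (?a 1) * Gamma (?a 2) * (\<Prod>j=3..p+1. Gamma (?a j))"
  proof -
    have "{1..p+1} = insert 1 (insert 2 {3..p+1})" using p by auto
    then show ?thesis by (simp add: mult.assoc)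
  qed
  let ?G = "Gamma (?a 1) * Gamma (?a 2) * rGamma (1 + of_nat l)"
  have t: "A_coeff p a b k * base_term (a 1) (a 2) k l = ?G * (A_coeff p a b k * rGamma (a 1 + a 2 + of_nat l + of_nat k))" for k
    by (simp add: base_term_def add_ac mult_ac)
  have "summable (\<lambda>k. A_coeff p a b k * rGamma (a 1 + a 2 + of_nat l + of_nat k))"
    using f unfolding fac_summable_def by (rule summable_norm_cancel)
  then have "(\<Sum>k. A_coeff p a b k * base_term (a 1) (a 2) k l) = ?G * fac_sum (a 1 + a 2 + of_nat l) (A_coeff p a b)"
    unfolding t by (rule suminf_mult)
  also have "fac_sum (a 1 + a 2 + of_nat l) (A_coeff p a b) = (\<Prod>j=3..p+1. Gamma (?a j)) * (\<Prod>j=1..p. rGamma (?b j))"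
    by (rule R(2))
  also have "?G * \<dots> = hyp_term p a b l" unfolding hyp_term_def prod by (simp only: mult_ac)
  finally show "hyp_term p a b l = (\<Sum>k. A_coeff p a b k * base_term (a 1) (a 2) k l)" ..
qed

theorem theorem4:
  fixes p :: nat and a b :: "nat \<Rightarrow> complex"
  assumes "p \<ge> 1"
    and "\<And>j. j \<in> {1..p+1} \<Longrightarrow> a j \<notin> \<int>\<^sub>\<le>\<^sub>0"
    and "\<And>j. j \<in> {3..p+1} \<Longrightarrow> Re (a j) > 0"
    and "(\<Sum>j=1..p. b j) - (\<Sum>j=1..p+1. a j) = 0"
  defines "A \<equiv> A_coeff p a b"
  defines "c \<equiv> \<lambda>k. Gamma (of_nat k) / (pochhammer (a 1) k * pochhammer (a 2) k) * A k"
  shows "summable (\<lambda>k. c (Suc k)) \<and>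
    (\<lambda>m. (\<Sum>l<m. hyp_term p a b l) -
           ((\<Sum>k. c (Suc k)) + Digamma 1 - Digamma (a 1) - Digamma (a 2) + Digamma (of_nat m)
            + (a 1 * a 2 - A 1) * inverse (of_nat m - 1)
            - 1 / 4 * (a 1 * (a 1 + 1) * (a 2 * (a 2 + 1))
                       - 2 * (a 1 + 1) * (a 2 + 1) * A 1 + 2 * A 2)
                * inverse ((of_nat m - 1) * (of_nat m - 2))))
      \<in> O(\<lambda>m. inverse (of_nat m ^ 3))"
proof -
  have a12: "a 1 \<notin> \<int>\<^sub>\<le>\<^sub>0" "a 2 \<notin> \<int>\<^sub>\<le>\<^sub>0" using assms(1,2) by auto
  have "{1..p+1} = insert 1 (insert 2 {3..p+1})" using assms(1) by auto
  then have "(\<Sum>j=1..p+1. a j) = a 1 + a 2 + (\<Sum>j=3..p+1. a j)"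
    by (simp add: add.assoc)
  then have s: "coeff_excess p a b = a 1 + a 2"
    using assms(4) by (simp add: coeff_excess_def algebra_simps)
  note S = hyp_term_eq_series[OF assms(1,3) s, folded A_def]
  have A0: "A 0 = 1" unfolding A_def by (rule A_coeff_0[OF assms(1)])
  have H: "hyp_term p a b = (\<lambda>l. \<Sum>k. A k * base_term (a 1) (a 2) k l)" by (rule ext) (rule S(2))
  show ?thesis unfolding H c_def by (rule conjI[OF factorial_series_partial_sums[OF a12 A0 S(1)]])
qed

end
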